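(* Let $\chi$ be a real and non-principal Dirichlet character. Suppose that for some $0\le\sigma<1$ the partial sums $\sum_{p\le x}\chi(p)p^{-\sigma}$ (over primes $p$) change sign only for a finite number of integers $x\ge 1$. Then there exists $\epsilon>0$ such that $L(s,\chi)\neq 0$ for all $s\in\mathbb{C}$ in the half plane $\mathrm{Re}(s)>1-\epsilon$.
   Context: $p$ denotes a generic prime number. $L(s,\chi)$ is the Dirichlet $L$-function of $\chi$: $L(s,\chi)=\sum_{n=1}^\infty \chi(n)n^{-s}$, which for non-principal $\chi$ converges and is analytic for $\mathrm{Re}(s)>0$ (and is otherwise understood by analytic continuation). Saying that the partial sums $A(x)=\sum_{p\le x}\chi(p)p^{-\sigma}$ change sign only for a finite number of integers $x\ge1$ means that there is $x_0>0$ such that either $A(x)\ge 0$ for all $x\ge x_0$, or $A(x)\le 0$ for all $x\ge x_0$. *)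

theory Defs
  imports "HOL-Analysis.Analysis" "HOL-Computational_Algebra.Primes"
begin

text \<open>
  A Dirichlet character modulo \<open>q\<close>, restricted to the natural numbers (by periodicity this loses
  no information). The value \<open>chi 1 = 1\<close> is a consequence of the last two conditions.
\<close>
definition dirichlet_character :: "nat \<Rightarrow> (nat \<Rightarrow> complex) \<Rightarrow> bool" where
  "dirichlet_character q chi \<longleftrightarrow>
     q > 0 \<and>
     (\<forall>n. chi (n + q) = chi n) \<and>
     (\<forall>m n. chi (m * n) = chi m * chi n) \<and>
     (\<forall>n. chi n \<noteq> 0 \<longleftrightarrow> coprime n q)"

definition principal_character :: "nat \<Rightarrow> nat \<Rightarrow> complex" where
  "principal_character q n = (if coprime n q then 1 else 0)"

definition real_character :: "(nat \<Rightarrow> complex) \<Rightarrow> bool" where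
  "real_character chi \<longleftrightarrow> (\<forall>n. chi n \<in> \<real>)"

definition L_term :: "(nat \<Rightarrow> complex) \<Rightarrow> complex \<Rightarrow> nat \<Rightarrow> complex" where
  "L_term chi s k = chi (Suc k) * of_nat (Suc k) powr (- s)"

text \<open>
  The \<open>L\<close>-function is the sum of its series wherever the series converges (in particular on
  \<open>Re s > 0\<close> for non-principal characters), and its analytic continuation elsewhere. The
  continuation is unique away from the point 1, the only place where (for principal characters)
  it has a pole.
\<close>
definition dirichlet_L :: "(nat \<Rightarrow> complex) \<Rightarrow> complex \<Rightarrow> complex" where
  "dirichlet_L chi s =
     (if summable (L_term chi s) then suminf (L_term chi s)
      else (SOME f. f holomorphic_on (- {1}) \<and> (\<forall>z. Re z > 1 \<longrightarrow> f z = suminf (L_term chi z))) s)"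

text \<open>Only meant for real characters, where \<open>Re (chi p)\<close> is just \<open>chi p\<close> as a real number.\<close>
definition prime_partial_sum :: "(nat \<Rightarrow> complex) \<Rightarrow> real \<Rightarrow> real \<Rightarrow> real" where
  "prime_partial_sum chi \<sigma> x = (\<Sum>p | prime p \<and> real p \<le> x. Re (chi p) * real p powr (- \<sigma>))"

definition finitely_many_sign_changes :: "(real \<Rightarrow> real) \<Rightarrow> bool" where
  "finitely_many_sign_changes A \<longleftrightarrow>
     (\<exists>x0>0. (\<forall>x\<ge>x0. A x \<ge> 0) \<or> (\<forall>x\<ge>x0. A x \<le> 0))"

end

theory Submission
  imports Defs "HOL-Complex_Analysis.Complex_Analysis" "HOL-Number_Theory.Residues"
begin

text \<open>
  Write \<open>P(s) = \<Sum>\<^sub>p \<chi>(p) p\<^sup>-\<^sup>s\<close> and \<open>H(s) = \<Prod>\<^sub>p (1 - \<chi>(p) p\<^sup>-\<^sup>s) exp(\<chi>(p) p\<^sup>-\<^sup>s)\<close>. The product \<open>H\<close> is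
  holomorphic without zeros for \<open>Re s > 1/2\<close>, and the Euler product reads \<open>L H = exp P\<close> for
  \<open>Re s > 1\<close>. Abel summation turns \<open>P(s) / (s - \<sigma>)\<close> into the Mellin transform
  \<open>\<integral> A(u) u\<^sup>-\<^sup>w\<^sup>-\<^sup>1 du\<close>, \<open>w = s - \<sigma>\<close>, whose integrand is eventually of one sign. By Landau's theorem
  its abscissa of convergence would be a singularity; but near every real point slightly to the
  left of \<open>1\<close> the function \<open>log (L H)\<close> is holomorphic, because \<open>L(1, \<chi>) \<noteq> 0\<close>. So the
  transform converges in some half plane \<open>Re s > 1 - \<epsilon>\<close>, where \<open>L H = exp P\<close> persists and has no zeros.
\<close>

section \<open>The Mellin kernel on unit intervals\<close>

text \<open>Landau's argument inspects only the real point at the abscissa of convergence. This is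
  why non-vanishing on a real interval ending at 1 suffices to exclude complex zeros, about which
  nothing is known beforehand. While such zeros are still possible there is no global logarithm, so
  the continued function is the product \<open>L H\<close> itself, and a logarithm is taken only on
  a disc about that real point. Since \<open>A\<close> is constant between consecutive integers, the
  Mellin transform is exactly the series of A(k+1) times the integral of u^(-w-1) over [k+1, k+2].
  All the analysis is therefore done on series of explicit kernels, and the sign hypothesis acts
  through the signs of their Taylor coefficients.\<close>

lemma norm_exp_diff_le:
  fixes w :: complex and a b x :: real
  assumes "0 \<le> a" "a < b" "0 < x" "x \<le> Re w"
  shows "norm (exp (- of_real b * w) - exp (- of_real a * w))
           \<le> norm w * ((exp (- a * x) - exp (- b * x)) / x)"
proof -
  have "norm (exp (- of_real b * w) - exp (- of_real a * w))
      \<le> - norm w * exp (- b * x) / x - (- norm w * exp (- a * x) / x)"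
  \<comment> \<open>The mean value inequality replaces an integral: the derivative has modulus |w|
    e^(-t Re w) \<le> |w| e^(-t x), and the right side is the derivative of the chosen
    majorant.\<close>
  proof (rule differentiable_bound_general[where f = "\<lambda>t. exp (- of_real t * w)"
        and f' = "\<lambda>t. - w * exp (- of_real t * w)"
        and \<phi> = "\<lambda>t. - norm w * exp (- t * x) / x"
        and \<phi>' = "\<lambda>t. norm w * exp (- t * x)"])
    show "a < b" by fact
    show "continuous_on {a..b} (\<lambda>t. exp (- of_real t * w))"
      by (intro continuous_intros)
    show "continuous_on {a..b} (\<lambda>t. - norm w * exp (- t * x) / x)"
      using assms by (intro continuous_intros) auto
  next
    fix t assume t: "a < t" "t < b"
    show "((\<lambda>t. exp (- of_real t * w)) has_vector_derivative - w * exp (- of_real t * w)) (at t)"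
      by (rule has_vector_derivative_real_field) (auto intro!: derivative_eq_intros)
    show "((\<lambda>t. - norm w * exp (- t * x) / x) has_vector_derivative norm w * exp (- t * x)) (at t)"
      unfolding has_real_derivative_iff_has_vector_derivative[symmetric]
      using assms by (auto intro!: derivative_eq_intros)
    have "exp (- (t * Re w)) \<le> exp (- (t * x))"
      using assms t by (simp add: mult_left_mono)
    then show "norm (- w * exp (- of_real t * w)) \<le> norm w * exp (- t * x)"
      by (simp add: norm_mult mult_left_mono)
  qed
  then show ?thesis
    by (simp add: diff_divide_distrib right_diff_distrib)
qed

text \<open>For \<open>w \<noteq> 0\<close> this is \<open>\<integral> u\<^sup>-\<^sup>w\<^sup>-\<^sup>1 du\<close> over \<open>[k + 1, k + 2]\<close>; the division makes its Taylor
  coefficients alternate in sign.\<close>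
definition power_gap :: "nat \<Rightarrow> complex \<Rightarrow> complex" where
  "power_gap k w = (of_nat (Suc k) powr (- w) - of_nat (Suc (Suc k)) powr (- w)) / w"

definition real_power_gap :: "nat \<Rightarrow> real \<Rightarrow> real" where
  "real_power_gap k x = (real (Suc k) powr (- x) - real (Suc (Suc k)) powr (- x)) / x"

lemma of_nat_powr_uminus:
  "n > 0 \<Longrightarrow> (of_nat n :: complex) powr (- w) = exp (- of_real (ln (real n)) * w)"
  by (simp add: powr_def Ln_of_nat mult.commute)

lemma power_gap_of_real: "power_gap k (of_real x) = of_real (real_power_gap k x)"
proof -
  have "of_nat n powr (- complex_of_real x) = of_real (real n powr (- x))" for n :: nat
    using powr_of_real[of "real n" "- x"] by simp
  then show ?thesis
    by (simp only: power_gap_def real_power_gap_def of_real_diff of_real_divide)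
qed

lemma real_power_gap_nonneg:
  assumes "x > 0" shows "real_power_gap k x \<ge> 0"
proof -
  have "real (Suc (Suc k)) powr (- x) \<le> real (Suc k) powr (- x)"
    using assms by (intro powr_mono2') auto
  then show ?thesis using assms by (simp add: real_power_gap_def)
qed

text \<open>Taking absolute values inside the integral of u^(-w-1) replaces \<open>w\<close> by its
  real part, and then by any smaller positive \<open>x\<close>. Hence absolute convergence at one
  real point controls a closed half plane uniformly.\<close>

lemma norm_power_gap_le:
  assumes "0 < x" "x \<le> Re w"
  shows "norm (power_gap k w) \<le> real_power_gap k x"
proof -
  have w: "w \<noteq> 0" using assms by auto
  have "norm (exp (- of_real (ln (real (Suc (Suc k)))) * w) - exp (- of_real (ln (real (Suc k))) * w))
      \<le> norm w * ((exp (- ln (real (Suc k)) * x) - exp (- ln (real (Suc (Suc k))) * x)) / x)"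
    using assms by (intro norm_exp_diff_le) auto
  also have "(exp (- ln (real (Suc k)) * x) - exp (- ln (real (Suc (Suc k))) * x)) / x = real_power_gap k x"
    by (simp add: real_power_gap_def powr_def mult.commute)
  finally show ?thesis using w
    by (simp only: power_gap_def of_nat_powr_uminus zero_less_Suc norm_divide norm_minus_commute)
       (simp add: divide_simps mult.commute)
qed

lemma power_gap_holomorphic [holomorphic_intros]:
  assumes "0 \<notin> S" shows "power_gap k holomorphic_on S"
  unfolding power_gap_def using assms
  by (intro holomorphic_intros) auto

text \<open>In probabilistic terms this is the chance that a Poisson variable of mean
  \<open>t\<close> is at most \<open>n\<close>. The derivative telescopes to -e^(-u) u^n /
  n!.\<close>

lemma exp_taylor_antimono:
  fixes s t :: real
  assumes "0 \<le> s" "s \<le> t"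
  shows "exp (- t) * (\<Sum>i\<le>n. t ^ i / fact i) \<le> exp (- s) * (\<Sum>i\<le>n. s ^ i / fact i)"
proof (rule DERIV_nonpos_imp_nonincreasing[OF assms(2)])
  fix u assume u: "s \<le> u" "u \<le> t"
  have D: "((\<lambda>u. \<Sum>i\<le>n. u ^ i / fact i) has_real_derivative (\<Sum>i<n. u ^ i / fact i)) (at u)" for n
  proof (induction n)
    case (Suc n)
    have "((\<lambda>u. u ^ Suc n / fact (Suc n)) has_real_derivative u ^ n / fact n) (at u)"
      by (auto intro!: derivative_eq_intros simp: divide_simps simp del: power_Suc of_nat_Suc)
    from DERIV_add[OF Suc this] show ?case
      by (simp add: lessThan_Suc_atMost[symmetric])
  qed auto
  have "((\<lambda>u. exp (- u) * (\<Sum>i\<le>n. u ^ i / fact i)) has_real_derivative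
      - exp (- u) * (u ^ n / fact n)) (at u)"
    by (rule derivative_eq_intros D refl)+
       (simp add: lessThan_Suc_atMost[symmetric] algebra_simps)
  moreover have "- exp (- u) * (u ^ n / fact n) \<le> 0"
    using u assms by simp
  ultimately show "\<exists>y. ((\<lambda>u. exp (- u) * (\<Sum>i\<le>n. u ^ i / fact i)) has_real_derivative y) (at u) \<and> y \<le> 0"
    by blast
qed

text \<open>Expanding at \<open>c\<close> in the variable z = c - w removes the alternation of
  signs. Behind the closed form, \<open>b j\<close> is the integral of e^(-c v) v^j / j! over
  [s, t], where \<open>s\<close> and \<open>t\<close> are the logarithms of k+1 and k+2. The radius
  \<open>c\<close> is the distance to w = 0, where the definition divides by zero.\<close>

lemma power_gap_power_series:
  assumes c: "c > (0::real)"
  obtains b :: "nat \<Rightarrow> real" where "\<And>j. b j \<ge> 0"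
    "\<And>z. norm z < c \<Longrightarrow> (\<lambda>j. of_real (b j) * z ^ j) sums power_gap k (of_real c - z)"
proof
  let ?E = "\<lambda>u j. exp (- u) * (\<Sum>i\<le>j. u ^ i / fact i)"
  define s where "s = ln (real (Suc k))"
  define t where "t = ln (real (Suc (Suc k)))"
  have st: "0 \<le> s" "s \<le> t" by (auto simp: s_def t_def)
  \<comment> \<open>the Cauchy product of the series of \<open>1 / (c - z)\<close> with that of \<open>e\<^sup>-\<^sup>s\<^sup>(\<^sup>c\<^sup>-\<^sup>z\<^sup>) - e\<^sup>-\<^sup>t\<^sup>(\<^sup>c\<^sup>-\<^sup>z\<^sup>)\<close>\<close>
  define b where "b j = (?E (c * s) j - ?E (c * t) j) / c ^ Suc j" for j
  show "b j \<ge> 0" for j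
    unfolding b_def using c st
    by (intro divide_nonneg_pos) (auto intro!: exp_taylor_antimono)
  fix z :: complex assume z: "norm z < c"
  define u where "u j = of_real (exp (- (c * s))) * (of_real s * z) ^ j /\<^sub>R fact j
      - of_real (exp (- (c * t))) * (of_real t * z) ^ j /\<^sub>R fact j" for j
  define v where "v j = z ^ j / of_real c ^ Suc j" for j
  have cz: "of_real c - z \<noteq> 0" using z c by auto
  have exps: "(\<lambda>j. of_real (exp (- (c * r))) * (of_real r * z) ^ j /\<^sub>R fact j)
      sums exp (- of_real r * (of_real c - z))" for r
    using sums_mult[OF exp_converges[of "of_real r * z"], of "of_real (exp (- (c * r)))"]
    by (simp add: exp_of_real[symmetric] exp_add[symmetric] algebra_simps del: exp_of_real)
  have norm_exps: "summable (\<lambda>j. norm (of_real (exp (- (c * r))) * (of_real r * z) ^ j /\<^sub>R fact j))" for r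
    using summable_mult[OF summable_norm_exp[of "of_real r * z"], of "exp (- (c * r))"]
    by (simp add: norm_mult mult.left_commute)
  have u: "u sums (exp (- of_real s * (of_real c - z)) - exp (- of_real t * (of_real c - z)))"
    unfolding u_def by (intro sums_diff exps)
  have nu: "summable (\<lambda>j. norm (u j))"
    unfolding u_def
    by (rule summable_comparison_test'[OF summable_add[OF norm_exps[of s] norm_exps[of t]], of 0])
       (simp add: norm_triangle_ineq4 del: norm_scaleR norm_mult)
  have zc: "norm (z / of_real c) < 1" using z c by (simp add: norm_divide)
  have v_eq: "v j = (z / of_real c) ^ j * (1 / of_real c)" for j
    using c by (simp add: v_def power_divide divide_simps)
  have "v sums (1 / (1 - z / of_real c) * (1 / of_real c))"
    unfolding v_eq by (intro sums_mult2 geometric_sums zc)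
  also have "1 / (1 - z / of_real c) * (1 / of_real c) = 1 / (of_real c - z)"
    using c cz by (simp add: field_simps)
  finally have v: "v sums (1 / (of_real c - z))" .
  have nv: "summable (\<lambda>j. norm (v j))"
    unfolding v_eq norm_mult norm_power
    by (intro summable_mult2 summable_geometric) (use zc in auto)
  have "(\<lambda>j. \<Sum>i\<le>j. u i * v (j - i)) sums ((\<Sum>j. u j) * (\<Sum>j. v j))"
    by (rule Cauchy_product_sums[OF nu nv])
  also have "(\<Sum>j. u j) * (\<Sum>j. v j) = power_gap k (of_real c - z)"
    unfolding sums_unique[OF u, symmetric] sums_unique[OF v, symmetric] power_gap_def s_def t_def
    by (simp only: of_nat_powr_uminus zero_less_Suc) simp
  also have "(\<lambda>j. \<Sum>i\<le>j. u i * v (j - i)) = (\<lambda>j. of_real (b j) * z ^ j)"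
  proof
    fix j
    have "u i * v (j - i) = of_real ((exp (- (c * s)) * ((c * s) ^ i / fact i)
        - exp (- (c * t)) * ((c * t) ^ i / fact i)) / c ^ Suc j) * z ^ j" if "i \<le> j" for i
    proof -
      have zj: "z ^ j = z ^ i * z ^ (j - i)" and cj: "c ^ j = c ^ i * c ^ (j - i)"
        using that by (simp_all add: power_add[symmetric])
      have "u i = of_real ((exp (- (c * s)) * s ^ i - exp (- (c * t)) * t ^ i) / fact i) * z ^ i"
        by (simp add: u_def scaleR_conv_of_real power_mult_distrib divide_simps) (simp add: algebra_simps)
      moreover have "v (j - i) = of_real (1 / c ^ Suc (j - i)) * z ^ (j - i)"
        by (simp add: v_def)
      ultimately have "u i * v (j - i) = of_real ((exp (- (c * s)) * s ^ i - exp (- (c * t)) * t ^ i) / fact i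
          * (1 / c ^ Suc (j - i))) * z ^ j"
        by (simp add: zj)
      also have "(exp (- (c * s)) * s ^ i - exp (- (c * t)) * t ^ i) / fact i * (1 / c ^ Suc (j - i))
          = (exp (- (c * s)) * ((c * s) ^ i / fact i)
        - exp (- (c * t)) * ((c * t) ^ i / fact i)) / c ^ Suc j"
        unfolding power_Suc cj power_mult_distrib using c by (simp add: divide_simps) (simp add: algebra_simps)
      finally show ?thesis .
    qed
    then have "(\<Sum>i\<le>j. u i * v (j - i)) = of_real (\<Sum>i\<le>j. (exp (- (c * s)) * ((c * s) ^ i / fact i)
        - exp (- (c * t)) * ((c * t) ^ i / fact i)) / c ^ Suc j) * z ^ j"
      unfolding of_real_sum sum_distrib_right by (intro sum.cong) auto
    then show "(\<Sum>i\<le>j. u i * v (j - i)) = of_real (b j) * z ^ j"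
      by (simp only: b_def sum_subtractf sum_divide_distrib[symmetric] sum_distrib_left)
  qed
  finally show "(\<lambda>j. of_real (b j) * z ^ j) sums power_gap k (of_real c - z)" .
qed

section \<open>Landau's theorem\<close>

text \<open>As all terms are non-negative, the double series may be summed in either order: first over
  \<open>n\<close>, giving the Taylor series of \<open>G\<close>, which converges in the larger disc.\<close>
lemma landau_power_series:
  fixes f :: "nat \<Rightarrow> complex \<Rightarrow> complex" and b :: "nat \<Rightarrow> nat \<Rightarrow> real"
  assumes b: "\<And>n k. b n k \<ge> 0"
    and f: "\<And>n z. norm z < R \<Longrightarrow> (\<lambda>k. of_real (b n k) * z ^ k) sums f n z"
    and G: "\<And>z. norm z < \<rho> \<Longrightarrow> (\<lambda>n. f n z) sums G z"
    and \<rho>: "0 < \<rho>" "\<rho> \<le> R"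
    and hol: "G holomorphic_on ball 0 R"
    and r: "0 \<le> r" "r < R"
  shows "summable (\<lambda>n. f n (of_real r))"
proof -
  define h where "h n x = (\<Sum>k. b n k * x ^ k)" for n and x :: real
  have sb: "summable (\<lambda>k. b n k * x ^ k)" if "0 \<le> x" "x < R" for n x
  proof -
    have "summable (\<lambda>k. of_real (b n k * x ^ k) :: complex)"
      using sums_summable[OF f[of "of_real x" n]] that by simp
    then show ?thesis by (simp only: summable_of_real_iff)
  qed
  have hs: "(\<lambda>k. b n k * x ^ k) sums h n x" if "0 \<le> x" "x < R" for n x
    unfolding h_def using sb[OF that] by (rule summable_sums)
  have fh: "f n (of_real x) = of_real (h n x)" if "0 \<le> x" "x < R" for n x
  proof -
    have "(\<lambda>k. of_real (b n k) * of_real x ^ k) sums (of_real (h n x) :: complex)"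
      using sums_of_real[OF hs[OF that], where 'a = complex] by simp
    then show ?thesis using f[of "of_real x" n] that sums_unique2 by auto
  qed
  have nn: "b n k * x ^ k \<ge> 0" if "0 \<le> x" for n k x using b that by simp
  have hnn: "h n x \<ge> 0" if "0 \<le> x" "x < R" for n x
    unfolding h_def by (intro suminf_nonneg sb that nn)
  have hsum: "((\<lambda>k. b n k * x ^ k) has_sum h n x) UNIV" if "0 \<le> x" "x < R" for n x
    using hs[OF that] nn[OF that(1)]
    by (simp add: norm_summable_imp_has_sum sums_iff)
  \<comment> \<open>In the small disc the outer series converges by the hypothesis on
    \<open>G\<close>; non-negative terms turn this into summability over all pairs.\<close>
  have dbl: "(\<lambda>(n, k). b n k * x ^ k) summable_on UNIV \<times> UNIV" if "0 \<le> x" "x < \<rho>" for x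
  proof (rule summable_on_SigmaI)
    show "((\<lambda>k. case (n, k) of (n, k) \<Rightarrow> b n k * x ^ k) has_sum h n x) UNIV" for n
      using hsum[of x n] that \<rho> by simp
    have "summable (\<lambda>n. f n (of_real x))"
      using G[of "of_real x"] that by (auto intro: sums_summable)
    then have "summable (\<lambda>n. h n x)"
      using fh that \<rho> by (simp add: summable_of_real_iff)
    then show "(\<lambda>n. h n x) summable_on UNIV"
      using hnn that \<rho> by (subst summable_on_UNIV_nonneg_real_iff) auto
  qed (use nn that in auto)
  define B where "B k = (\<Sum>\<^sub>\<infinity>n. b n k)" for k
  have sumb: "(\<lambda>n. b n k) summable_on UNIV" for k
  proof -
    \<comment> \<open>One positive point inside the small disc is enough: the fixed factor (\<rho> /
      2)^k can be divided out of each column.\<close>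
    have "(\<lambda>(k, n). b n k * (\<rho> / 2) ^ k) summable_on UNIV \<times> UNIV"
      using dbl[of "\<rho> / 2"] \<rho> by (subst summable_on_swap) (auto simp: case_prod_unfold)
    then have "(\<lambda>n. b n k * (\<rho> / 2) ^ k) summable_on UNIV"
      by (rule summable_on_SigmaD1) simp
    then show ?thesis
      using \<rho> by (subst (asm) summable_on_cmult_left') auto
  qed
  have Bsum: "((\<lambda>n. b n k) has_sum B k) UNIV" for k
    unfolding B_def using sumb by (rule has_sum_infsum)
  have GB: "(\<lambda>k. of_real (B k) * z ^ k) sums G z" if z: "norm z < \<rho>" for z
  proof -
    have "(\<lambda>x. norm (case x of (n, k) \<Rightarrow> of_real (b n k) * z ^ k)) summable_on UNIV \<times> UNIV"
      using dbl[of "norm z"] z b by (simp add: case_prod_unfold norm_mult norm_power)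
    then have "(\<lambda>(n, k). of_real (b n k) * z ^ k) summable_on UNIV \<times> UNIV"
      by (rule abs_summable_summable)
    then obtain S where S: "((\<lambda>(n, k). of_real (b n k) * z ^ k) has_sum S) (UNIV \<times> UNIV)"
      by (auto simp: summable_on_def)
    have zR: "norm z < R" using z \<rho> by simp
    have "((\<lambda>k. of_real (b n k) * z ^ k) has_sum f n z) UNIV" for n
    proof (rule norm_summable_imp_has_sum[OF _ f[OF zR]])
      show "summable (\<lambda>k. norm (of_real (b n k) * z ^ k))"
        using sb[of "norm z" n] zR b by (simp add: norm_mult norm_power)
    qed
    then have "((\<lambda>n. f n z) has_sum S) UNIV"
      using S by (intro has_sum_SigmaD[OF S]) auto
    then have "S = G z"
      using has_sum_imp_sums G[OF z] sums_unique2 by blast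
    moreover have "((\<lambda>k. of_real (B k) * z ^ k) has_sum S) UNIV"
    proof (rule has_sum_SigmaD)
      show "((\<lambda>(k, n). of_real (b n k) * z ^ k) has_sum S) (UNIV \<times> UNIV)"
        using S by (subst has_sum_swap) (simp add: case_prod_unfold)
      show "((\<lambda>n. case (k, n) of (k, n) \<Rightarrow> of_real (b n k) * z ^ k) has_sum of_real (B k) * z ^ k) UNIV" for k
        using has_sum_cmult_left[OF has_sum_of_real[OF Bsum[of k], where 'a = complex], of "z ^ k"] by simp
    qed
    ultimately show ?thesis using has_sum_imp_sums by blast
  qed
  define C where "C k = (deriv ^^ k) G 0 / fact k" for k
  have GC: "(\<lambda>k. C k * z ^ k) sums G z" if "norm z < R" for z
    using holomorphic_power_series[OF hol, of z] that by (simp add: C_def)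
  \<comment> \<open>The crux: near 0 both series represent \<open>G\<close>, so the column sums are
    its Taylor coefficients and inherit convergence in the whole disc of radius
    \<open>R\<close>.\<close>
  have "C k = of_real (B k)" for k
  proof -
    have e1: "eventually (\<lambda>z. z \<in> ball 0 \<rho>) (nhds (0::complex))"
      using \<rho> by (intro eventually_nhds_in_open) auto
    have 1: "G has_fps_expansion Abs_fps (\<lambda>k. of_real (B k))"
      by (intro has_fps_expansionI eventually_mono[OF e1]) (auto intro: GB)
    have 2: "G has_fps_expansion Abs_fps C"
      by (intro has_fps_expansionI eventually_mono[OF e1]) (use \<rho> in \<open>auto intro!: GC\<close>)
    have "Abs_fps C = Abs_fps (\<lambda>k. of_real (B k))"
      using 1 2 fps_expansion_unique_complex by blast
    then show ?thesis by (simp add: fps_eq_iff)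
  qed
  then have "summable (\<lambda>k. of_real (B k) * (of_real r :: complex) ^ k)"
    using GC[of "of_real r"] r by (auto intro: sums_summable)
  then have "summable (\<lambda>k. of_real (B k * r ^ k) :: complex)"
    by simp
  then have "summable (\<lambda>k. B k * r ^ k)"
    by (simp only: summable_of_real_iff)
  moreover have Bnn: "B k \<ge> 0" for k
    unfolding B_def using b by (intro infsum_nonneg) auto
  ultimately have Bs: "(\<lambda>k. B k * r ^ k) summable_on UNIV"
    using r by (subst summable_on_UNIV_nonneg_real_iff) auto
  \<comment> \<open>Now the opposite order at \<open>r\<close>, which may lie outside the small
    disc: by positivity, convergence of the series of column sums yields summability over all
    pairs.\<close>
  have "(\<lambda>(k, n). b n k * r ^ k) summable_on UNIV \<times> UNIV"
  proof (rule summable_on_SigmaI[OF _ Bs])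
    show "((\<lambda>n. case (k, n) of (k, n) \<Rightarrow> b n k * r ^ k) has_sum B k * r ^ k) UNIV" for k
      using has_sum_cmult_left[OF Bsum[of k], of "r ^ k"] by simp
  qed (use nn r in auto)
  then have "(\<lambda>(n, k). b n k * r ^ k) summable_on UNIV \<times> UNIV"
    by (subst summable_on_swap) (auto simp: case_prod_unfold)
  then obtain S where S: "((\<lambda>(n, k). b n k * r ^ k) has_sum S) (UNIV \<times> UNIV)"
    by (auto simp: summable_on_def)
  have "((\<lambda>n. h n r) has_sum S) UNIV"
    by (rule has_sum_SigmaD[OF S]) (use hsum r in auto)
  then have "summable (\<lambda>n. h n r)"
    using has_sum_imp_sums sums_summable by blast
  then show ?thesis using fh r by (simp add: summable_of_real_iff)
qed

text \<open>Serves to compare two holomorphic logarithms of one function. Differentiating exp h = 1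
  gives h' = 0, because exp has no zeros.\<close>

lemma exp_eq_1_imp_constant_on:
  assumes hol: "h holomorphic_on S" and S: "open S" "convex S"
    and h: "\<And>z. z \<in> S \<Longrightarrow> exp (h z) = 1"
  shows "\<exists>k. \<forall>z\<in>S. h z = k"
proof (rule has_field_derivative_zero_constant[OF S(2)])
  fix z assume z: "z \<in> S"
  obtain h' where h': "(h has_field_derivative h') (at z)"
    using hol S z holomorphic_on_open by blast
  have "((\<lambda>z. exp (h z)) has_field_derivative exp (h z) * h') (at z)"
    by (rule DERIV_fun_exp[OF h'])
  moreover have "((\<lambda>z. exp (h z)) has_field_derivative 0) (at z)"
    by (rule has_field_derivative_transform_within_open[of "\<lambda>_. 1", OF _ S(1) z]) (auto simp: h)
  ultimately have "exp (h z) * h' = 0" by (rule DERIV_unique)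
  then show "(h has_field_derivative 0) (at z within S)"
    using h' by (auto intro: has_field_derivative_at_within)
qed

lemma power_gap_series_uniform_limit:
  fixes a :: "nat \<Rightarrow> complex"
  assumes "x > 0" and sm: "summable (\<lambda>n. norm (a n) * real_power_gap n x)"
  shows "uniform_limit {w. x \<le> Re w} (\<lambda>n w. \<Sum>i<n. a i * power_gap i w)
           (\<lambda>w. \<Sum>i. a i * power_gap i w) sequentially"
    and "x \<le> Re w \<Longrightarrow> summable (\<lambda>n. a n * power_gap n w)"
proof -
  have b: "norm (a n * power_gap n w) \<le> norm (a n) * real_power_gap n x" if "x \<le> Re w" for n w
    using norm_power_gap_le[OF assms(1) that] by (simp add: norm_mult mult_left_mono)
  show "uniform_limit {w. x \<le> Re w} (\<lambda>n w. \<Sum>i<n. a i * power_gap i w)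
           (\<lambda>w. \<Sum>i. a i * power_gap i w) sequentially"
    by (rule Weierstrass_m_test[OF _ sm]) (use b in auto)
  show "summable (\<lambda>n. a n * power_gap n w)" if "x \<le> Re w"
    by (rule summable_comparison_test'[OF sm]) (use b that in auto)
qed

lemma power_gap_series_holomorphic:
  fixes a :: "nat \<Rightarrow> complex"
  assumes "x0 \<ge> 0" and sm: "\<And>x. x > x0 \<Longrightarrow> summable (\<lambda>n. norm (a n) * real_power_gap n x)"
  shows "(\<lambda>w. \<Sum>n. a n * power_gap n w) holomorphic_on {w. x0 < Re w}"
proof (rule holomorphic_uniform_sequence[where f = "\<lambda>n w. \<Sum>i<n. a i * power_gap i w"])
  show "open {w. x0 < Re w}" by (rule open_halfspace_Re_gt)
  show "(\<lambda>w. \<Sum>i<n. a i * power_gap i w) holomorphic_on {w. x0 < Re w}" for n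
    using assms(1) by (intro holomorphic_intros) auto
  fix w assume w: "w \<in> {w. x0 < Re w}"
  define d where "d = (Re w - x0) / 2"
  have d: "d > 0" using w by (simp add: d_def)
  have sub: "cball w d \<subseteq> {z. x0 + d \<le> Re z}"
  proof
    fix z assume "z \<in> cball w d"
    then have "\<bar>Re w - Re z\<bar> \<le> d"
      using abs_Re_le_cmod[of "w - z"] by (simp add: dist_norm)
    then show "z \<in> {z. x0 + d \<le> Re z}" by (auto simp: d_def abs_le_iff field_simps abs_if split: if_splits)
  qed
  show "\<exists>d>0. cball w d \<subseteq> {w. x0 < Re w} \<and> uniform_limit (cball w d)
      (\<lambda>n w. \<Sum>i<n. a i * power_gap i w) (\<lambda>w. \<Sum>n. a n * power_gap n w) sequentially"
  proof (intro exI[of _ d] conjI)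
    show "cball w d \<subseteq> {w. x0 < Re w}" using sub d by force
    show "uniform_limit (cball w d) (\<lambda>n w. \<Sum>i<n. a i * power_gap i w)
        (\<lambda>w. \<Sum>n. a n * power_gap n w) sequentially"
      by (rule uniform_limit_on_subset[OF power_gap_series_uniform_limit(1) sub])
         (use assms d in auto)
  qed (rule d)
qed

text \<open>Zeros are excluded in advance only on the real axis; in the half plane their absence is
  the conclusion, which comes from extending the exponential formula. The factor \<open>w\<close>
  undoes the division in \<open>power_gap\<close>, and \<open>\<eta>\<close> allows the series to be
  negated.\<close>

theorem landau_power_gap_series:
  fixes a :: "nat \<Rightarrow> real" and M :: "complex \<Rightarrow> complex" and \<eta> :: complex
  assumes a: "\<And>n. n \<ge> N \<Longrightarrow> a n \<ge> 0"
    and \<alpha>: "\<alpha> \<ge> 0"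
    and M: "M holomorphic_on {w. \<alpha> < Re w}"
    and M_real: "\<And>x. x > \<alpha> \<Longrightarrow> M (of_real x) \<noteq> 0"
    and \<eta>: "\<eta> \<noteq> 0"
    and sm: "\<And>w. Re w > X \<Longrightarrow> summable (\<lambda>n. of_real (a n) * power_gap n w)"
    and M_eq: "\<And>w. Re w > X \<Longrightarrow> M w = exp (\<eta> * w * (\<Sum>n. of_real (a n) * power_gap n w))"
    and w: "Re w > \<alpha>"
  shows "M w \<noteq> 0"
proof -
  define F where "F = (\<lambda>w. \<Sum>n. of_real (a n) * power_gap n w)"
  \<comment> \<open>Absolute convergence is recorded because it passes to larger real parts by
    domination. On the real axis it follows from plain convergence, all but finitely many terms
    being non-negative.\<close>
  define T where "T = {x. \<alpha> < x \<and> summable (\<lambda>n. norm (of_real (a n) :: complex) * real_power_gap n x)}"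
  have T_mem: "x \<in> T" if x: "\<alpha> < x" and s: "summable (\<lambda>n. of_real (a n) * power_gap n (of_real x))" for x
  proof -
    from s have "summable (\<lambda>n. of_real (a n * real_power_gap n x) :: complex)"
      by (simp add: power_gap_of_real)
    then have "summable (\<lambda>n. a n * real_power_gap n x)"
      by (simp only: summable_of_real_iff)
    moreover have "eventually (\<lambda>n. norm (of_real (a n) :: complex) * real_power_gap n x = a n * real_power_gap n x) sequentially"
      using eventually_ge_at_top[of N] by eventually_elim (use a in auto)
    ultimately have "summable (\<lambda>n. norm (of_real (a n) :: complex) * real_power_gap n x)"
      using summable_cong by fastforce
    with x show ?thesis by (simp add: T_def)
  qed
  define y where "y = max X \<alpha> + 1"
  have y: "y \<in> T"
    by (rule T_mem) (auto simp: y_def intro!: sm)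
  \<comment> \<open>The abscissa of absolute convergence, cut off at \<open>\<alpha>\<close>; the
    aim is to show that it equals \<open>\<alpha>\<close>.\<close>
  define x0 where "x0 = Inf T"
  have bdd: "bdd_below T" by (auto simp: T_def intro!: bdd_belowI[of _ \<alpha>])
  have x0: "\<alpha> \<le> x0" unfolding x0_def using y by (intro cInf_greatest) (auto simp: T_def)
  have x0y: "x0 \<le> y" unfolding x0_def using y bdd by (rule cInf_lower)
  have smn: "summable (\<lambda>n. norm (of_real (a n) :: complex) * real_power_gap n x)" if "x0 < x" for x
  proof -
    have "T \<noteq> {}" "Inf T < x" using y that by (auto simp: x0_def)
    then obtain t where t: "t \<in> T" "t < x"
      using cInf_lessD by metis
    have t0: "0 < t" using t \<alpha> by (auto simp: T_def)
    have "norm (real_power_gap n x) \<le> real_power_gap n t" for n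
      using norm_power_gap_le[OF t0, of "of_real x" n] t by (simp add: power_gap_of_real)
    then have "norm (norm (of_real (a n) :: complex) * real_power_gap n x)
        \<le> norm (of_real (a n) :: complex) * real_power_gap n t" for n
      by (simp add: abs_mult mult_left_mono)
    moreover have "summable (\<lambda>n. norm (of_real (a n) :: complex) * real_power_gap n t)"
      using t(1) unfolding T_def by blast
    ultimately show ?thesis
      by (rule summable_comparison_test'[rotated])
  qed
  have F_sums: "(\<lambda>n. of_real (a n) * power_gap n w) sums F w" if "Re w > x0" for w
  proof -
    have "x0 < Re w" "0 < Re w" using that x0 \<alpha> by auto
    then show ?thesis unfolding F_def
      by (intro summable_sums power_gap_series_uniform_limit(2)[of "Re w"] smn) auto
  qed
  have F_hol: "F holomorphic_on {w. x0 < Re w}"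
    unfolding F_def using x0 \<alpha> by (intro power_gap_series_holomorphic smn) auto
  have M_exp: "M w = exp (\<eta> * w * F w)" if "Re w > x0" for w
  proof (rule analytic_continuation_open[of "{w. y < Re w}" "{w. x0 < Re w}" M "\<lambda>w. exp (\<eta> * w * F w)"])
    show "M holomorphic_on {w. x0 < Re w}"
      by (rule holomorphic_on_subset[OF M]) (use x0 in auto)
    show "(\<lambda>w. exp (\<eta> * w * F w)) holomorphic_on {w. x0 < Re w}"
      by (intro holomorphic_intros F_hol)
    show "{w. y < Re w} \<noteq> {}" by (auto intro!: exI[of _ "of_real (y + 1)"])
    show "M z = exp (\<eta> * z * F z)" if "z \<in> {w. y < Re w}" for z
      using that M_eq[of z] by (auto simp: F_def y_def)
  qed (use that x0y in \<open>auto intro!: open_halfspace_Re_gt convex_connected convex_halfspace_Re_gt\<close>)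
  \<comment> \<open>otherwise a logarithm of \<open>M\<close> continues \<open>F\<close> to a disc around \<open>x0\<close>, and Landau's argument
    makes the series converge to the left of \<open>x0\<close>\<close>
  have "\<not> \<alpha> < x0"
  proof
    assume less: "\<alpha> < x0"
    have "open {w. \<alpha> < Re w}" by (rule open_halfspace_Re_gt)
    moreover have "continuous_on {w. \<alpha> < Re w} M"
      using M by (rule holomorphic_on_imp_continuous_on)
    ultimately have "open (M -` (- {0}) \<inter> {w. \<alpha> < Re w})"
      by (intro continuous_open_preimage[where S = "{w. \<alpha> < Re w}", simplified Int_commute]) auto
    moreover have "of_real x0 \<in> M -` (- {0}) \<inter> {w. \<alpha> < Re w}"
      using M_real[OF less] less by simp
    ultimately obtain \<delta> where \<delta>: "\<delta> > 0" "ball (of_real x0) \<delta> \<subseteq> M -` (- {0}) \<inter> {w. \<alpha> < Re w}"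
      by (meson open_contains_ball)
    obtain \<Lambda> where \<Lambda>: "\<Lambda> holomorphic_on ball (of_real x0) \<delta>"
        "\<And>z. z \<in> ball (of_real x0) \<delta> \<Longrightarrow> M z = exp (\<Lambda> z)"
    proof (rule contractible_imp_holomorphic_log)
      show "M holomorphic_on ball (of_real x0) \<delta>"
        by (rule holomorphic_on_subset[OF M]) (use \<delta> in auto)
    qed (use \<delta> in \<open>auto intro: convex_imp_contractible\<close>)
    \<comment> \<open>The centre lies \<delta>/4 to the right of \<open>x0\<close>. The disc of
      radius \<delta>/4 then lies where the series converges, while that of radius \<delta>/2 stays
      in the domain of the logarithm and reaches \<delta>/4 to the left of \<open>x0\<close>. The
      value 3\<delta>/8 used below corresponds to the point x0 - \<delta>/8.\<close>
    define c where "c = x0 + \<delta> / 4"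
    have c: "x0 < c" "c > 0" using \<delta> x0 \<alpha> by (auto simp: c_def)
    have near: "z \<in> ball (of_real x0) \<delta>" if "norm (z - of_real c) < \<delta> / 2" for z :: complex
    proof -
      have "norm (z - of_real x0) \<le> norm (z - of_real c) + norm (of_real c - of_real x0 :: complex)"
        using norm_triangle_ineq[of "z - of_real c" "of_real c - of_real x0"] by simp
      also have "of_real c - of_real x0 = (of_real (\<delta> / 4) :: complex)" by (simp add: c_def)
      finally show ?thesis using that \<delta> by (simp add: dist_norm norm_minus_commute)
    qed
    have right: "x0 < Re z" if "norm (z - of_real c) < \<delta> / 4" for z
      using abs_Re_le_cmod[of "z - of_real c"] that by (simp add: c_def)
    have "\<exists>k. \<forall>z\<in>ball (of_real c) (\<delta> / 4). \<eta> * z * F z - \<Lambda> z = k"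
    proof (rule exp_eq_1_imp_constant_on)
      show "(\<lambda>z. \<eta> * z * F z - \<Lambda> z) holomorphic_on ball (of_real c) (\<delta> / 4)"
      proof (intro holomorphic_intros)
        show "F holomorphic_on ball (of_real c) (\<delta> / 4)"
          by (rule holomorphic_on_subset[OF F_hol]) (auto simp: dist_norm norm_minus_commute intro: right)
        show "\<Lambda> holomorphic_on ball (of_real c) (\<delta> / 4)"
        proof (rule holomorphic_on_subset[OF \<Lambda>(1)])
          show "ball (of_real c) (\<delta> / 4) \<subseteq> ball (complex_of_real x0) \<delta>"
          proof
            fix z :: complex assume "z \<in> ball (of_real c) (\<delta> / 4)"
            then show "z \<in> ball (of_real x0) \<delta>"
              using \<delta>(1) by (intro near) (simp add: dist_norm norm_minus_commute)
          qed
        qed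
      qed
      fix z assume "z \<in> ball (complex_of_real c) (\<delta> / 4)"
      then have z: "norm (z - of_real c) < \<delta> / 4" by (simp add: dist_norm norm_minus_commute)
      then have "z \<in> ball (of_real x0) \<delta>" using \<delta> by (intro near) auto
      then have "exp (\<eta> * z * F z) = exp (\<Lambda> z)"
        using M_exp[OF right[OF z]] \<Lambda>(2) by simp
      then show "exp (\<eta> * z * F z - \<Lambda> z) = 1" by (simp add: exp_diff)
    qed auto
    then obtain k where k: "\<And>z. norm (z - of_real c) < \<delta> / 4 \<Longrightarrow> \<eta> * z * F z - \<Lambda> z = k"
      by (auto simp: dist_norm norm_minus_commute)
    \<comment> \<open>The value of the series as solved from the logarithm, minus the first
      \<open>N\<close> terms, whose coefficients may be negative.\<close>
    define G where "G z = (\<Lambda> (of_real c - z) + k) / (\<eta> * (of_real c - z))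
        - (\<Sum>n<N. of_real (a n) * power_gap n (of_real c - z))" for z
    have nz: "z \<noteq> of_real c" "of_real c - z \<noteq> 0" "of_real c - z \<in> ball (of_real x0) \<delta>" if "z \<in> ball 0 (\<delta> / 2)" for z :: complex
    proof -
      show "of_real c - z \<in> ball (of_real x0) \<delta>" using that by (intro near) auto
      then have "of_real c - z \<in> {w. \<alpha> < Re w}" using \<delta> by blast
      then show "of_real c - z \<noteq> 0" using \<alpha> by (metis mem_Collect_eq not_le zero_complex.simps(1))
      then show "z \<noteq> of_real c" by auto
    qed
    have G_hol: "G holomorphic_on ball 0 (\<delta> / 2)"
      unfolding G_def
    proof (intro holomorphic_intros)
      have 1: "(\<lambda>z. complex_of_real c - z) ` ball 0 (\<delta> / 2) \<subseteq> ball (complex_of_real x0) \<delta>"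
        by (rule image_subsetI) (rule nz(3))
      have h: "(\<lambda>z. complex_of_real c - z) holomorphic_on ball 0 (\<delta> / 2)" by (intro holomorphic_intros)
      show "(\<lambda>z. \<Lambda> (of_real c - z)) holomorphic_on ball 0 (\<delta> / 2)"
        using holomorphic_on_compose_gen[OF h \<Lambda>(1) 1] by (simp add: o_def)
      have 2: "(\<lambda>z. complex_of_real c - z) ` ball 0 (\<delta> / 2) \<subseteq> - {0}"
        by (rule image_subsetI) (use nz(2) in simp)
      have 3: "power_gap i holomorphic_on - {0}" for i by (rule power_gap_holomorphic) simp
      show "(\<lambda>z. power_gap i (of_real c - z)) holomorphic_on ball 0 (\<delta> / 2)" for i
        using holomorphic_on_compose_gen[OF h 3 2] by (simp add: o_def)
    qed (use nz \<eta> in auto)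
    define f where "f n z = of_real (a (n + N)) * power_gap (n + N) (of_real c - z)" for n z
    have "\<exists>b. (\<forall>j. b j \<ge> 0) \<and> (\<forall>z. norm z < c \<longrightarrow> (\<lambda>j. of_real (b j) * z ^ j) sums power_gap n (of_real c - z))" for n
      using power_gap_power_series[OF c(2), of n] by metis
    then obtain b where b: "\<And>n j. b n j \<ge> 0"
      "\<And>n z. norm z < c \<Longrightarrow> (\<lambda>j. of_real (b n j) * z ^ j) sums power_gap n (of_real c - z)"
      by metis
    have \<delta>x: "\<alpha> < x0 - \<delta> / 8"
    proof -
      have "of_real (x0 - \<delta> / 8) \<in> ball (complex_of_real x0) \<delta>"
        using \<delta> by (simp add: dist_norm)
      then have "of_real (x0 - \<delta> / 8) \<in> {w. \<alpha> < Re w}" using \<delta> by blast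
      then show ?thesis by simp
    qed
    \<comment> \<open>Otherwise the disc of radius \<delta>/2 about \<open>c\<close> would contain
      0, which lies outside Re w > \<alpha>. So the kernel expansions, of radius \<open>c\<close>,
      are valid on the whole disc.\<close>
    have \<delta>c: "\<delta> / 2 \<le> c"
    proof (rule ccontr)
      assume "\<not> \<delta> / 2 \<le> c"
      then have "of_real c \<in> ball (0::complex) (\<delta> / 2)" using c by simp
      then show False using nz(1) by blast
    qed
    have "summable (\<lambda>n. f n (of_real (3 * \<delta> / 8)))"
    proof (rule landau_power_series[where f = f and b = "\<lambda>n j. a (n + N) * b (n + N) j" and G = G and R = "\<delta> / 2" and \<rho> = "\<delta> / 4"])
      show "(\<lambda>k. of_real (a (n + N) * b (n + N) k) * z ^ k) sums f n z" if "norm z < \<delta> / 2" for n z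
        using sums_mult[OF b(2)[of z "n + N"], of "of_real (a (n + N))"] that \<delta>c
        by (simp add: f_def mult.assoc)
      fix z :: complex assume z: "norm z < \<delta> / 4"
      then have cz: "norm (of_real c - z - of_real c) < \<delta> / 4" by simp
      have zb: "z \<in> ball 0 (\<delta> / 2)" using z \<delta> by simp
      have "(\<lambda>n. f n z) sums (F (of_real c - z) - (\<Sum>n<N. of_real (a n) * power_gap n (of_real c - z)))"
        unfolding f_def by (rule sums_split_initial_segment[OF F_sums[OF right[OF cz]]])
      moreover have "F (of_real c - z) = (\<Lambda> (of_real c - z) + k) / (\<eta> * (of_real c - z))"
        using k[OF cz] nz(2)[OF zb] \<eta> by (simp add: divide_simps) (auto simp: algebra_simps)
      ultimately show "(\<lambda>n. f n z) sums G z" by (simp only: G_def)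
    qed (use a b \<delta> G_hol in auto)
    then have "summable (\<lambda>n. of_real (a n) * power_gap n (of_real c - of_real (3 * \<delta> / 8)))"
      unfolding f_def by (subst (asm) summable_iff_shift)
    moreover have "complex_of_real c - of_real (3 * \<delta> / 8) = of_real (x0 - \<delta> / 8)"
      by (simp add: c_def)
    ultimately have "x0 - \<delta> / 8 \<in> T" using \<delta>x by (intro T_mem) auto
    then have "x0 \<le> x0 - \<delta> / 8" unfolding x0_def using bdd by (rule cInf_lower)
    then show False using \<delta> by simp
  qed
  then have "Re w > x0" using w by simp
  then show ?thesis using M_exp by simp
qed

section \<open>Abel summation\<close>

lemma norm_powr_of_nat: "n > 0 \<Longrightarrow> norm ((of_nat n :: complex) powr (- s)) = real n powr (- Re s)"
  using norm_powr_real_powr[of "of_nat n" "- s"] by simp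

lemma norm_powr_of_nat_le: "norm ((of_nat n :: complex) powr (- s)) \<le> real n powr (- Re s)"
  by (cases "n = 0") (simp_all add: norm_powr_of_nat)

lemma powr_neg_LIMSEQ_0: "x > 0 \<Longrightarrow> (\<lambda>n. real (Suc n) powr (- x)) \<longlonglongrightarrow> 0"
  by (rule tendsto_neg_powr[OF _ filterlim_compose[OF filterlim_real_sequentially filterlim_Suc]]) simp

lemma summable_real_power_gap:
  assumes "x > 0" shows "summable (\<lambda>n. real_power_gap n x)"
proof -
  have "summable (\<lambda>n. real (Suc n) powr (- x) - real (Suc (Suc n)) powr (- x))"
    by (rule telescope_summable'[OF powr_neg_LIMSEQ_0[OF assms]])
  then show ?thesis unfolding real_power_gap_def by (rule summable_divide)
qed

text \<open>\<open>c k\<close> belongs to the integer k+1, hence the boundary factor at N+1. The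
  leading \<open>w\<close> cancels the division in \<open>power_gap\<close>.\<close>

lemma abel_summation_power_gap:
  assumes "w \<noteq> 0"
  shows "(\<Sum>k<N. c k * of_nat (Suc k) powr (- w)) =
    (\<Sum>k<N. c k) * of_nat (Suc N) powr (- w) + w * (\<Sum>k<N. (\<Sum>i\<le>k. c i) * power_gap k w)"
proof (induction N)
  case (Suc N)
  have g: "w * power_gap N w = of_nat (Suc N) powr (- w) - of_nat (Suc (Suc N)) powr (- w)"
    using assms by (simp add: power_gap_def)
  have "w * (\<Sum>k<Suc N. (\<Sum>i\<le>k. c i) * power_gap k w) =
      w * (\<Sum>k<N. (\<Sum>i\<le>k. c i) * power_gap k w) + (\<Sum>i<Suc N. c i) * (w * power_gap N w)"
    by (subst sum.lessThan_Suc) (simp add: lessThan_Suc_atMost algebra_simps del: sum.lessThan_Suc)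
  then show ?case unfolding g sum.lessThan_Suc Suc.IH
    by (simp add: algebra_simps del: of_nat_Suc)
qed auto

text \<open>Both directions serve: with bounded partial sums the kernel series is known to converge,
  for the primes the Dirichlet series is.\<close>

lemma abel_sums_power_gap_iff:
  assumes "w \<noteq> 0"
    and "(\<lambda>N. (\<Sum>k<N. c k) * of_nat (Suc N) powr (- w)) \<longlonglongrightarrow> 0"
  shows "(\<lambda>k. (\<Sum>i\<le>k. c i) * power_gap k w) sums l \<longleftrightarrow>
    (\<lambda>k. c k * of_nat (Suc k) powr (- w)) sums (w * l)"
proof -
  have "(\<lambda>k. (\<Sum>i\<le>k. c i) * power_gap k w) sums l \<longleftrightarrow>
     (\<lambda>N. w * (\<Sum>k<N. (\<Sum>i\<le>k. c i) * power_gap k w)) \<longlonglongrightarrow> w * l"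
    using assms(1) by (simp add: sums_def tendsto_mult_left_iff)
  also have "\<dots> \<longleftrightarrow> (\<lambda>k. c k * of_nat (Suc k) powr (- w)) sums (w * l)"
  proof
    assume "(\<lambda>N. w * (\<Sum>k<N. (\<Sum>i\<le>k. c i) * power_gap k w)) \<longlonglongrightarrow> w * l"
    from tendsto_add[OF assms(2) this] show "(\<lambda>k. c k * of_nat (Suc k) powr (- w)) sums (w * l)"
      unfolding sums_def abel_summation_power_gap[OF assms(1)] by simp
  next
    assume "(\<lambda>k. c k * of_nat (Suc k) powr (- w)) sums (w * l)"
    then have "(\<lambda>N. (\<Sum>k<N. c k * of_nat (Suc k) powr (- w))) \<longlonglongrightarrow> w * l"
      by (simp only: sums_def)
    from tendsto_diff[OF this assms(2)]
    show "(\<lambda>N. w * (\<Sum>k<N. (\<Sum>i\<le>k. c i) * power_gap k w)) \<longlonglongrightarrow> w * l"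
      unfolding abel_summation_power_gap[OF assms(1)] by simp
  qed
  finally show ?thesis .
qed

text \<open>The real kernels telescope, so bounded partial sums make the kernel series converge
  absolutely for Re w > 0, where the Dirichlet series itself may converge only conditionally. The
  third claim later yields holomorphy.\<close>

lemma bounded_partial_sums_dirichlet_series:
  fixes c :: "nat \<Rightarrow> complex"
  assumes B: "\<And>n. norm (\<Sum>k<n. c k) \<le> B"
  shows "\<And>w. Re w > 0 \<Longrightarrow> summable (\<lambda>k. c k * of_nat (Suc k) powr (- w))"
    and "\<And>w. Re w > 0 \<Longrightarrow> (\<Sum>k. c k * of_nat (Suc k) powr (- w)) = w * (\<Sum>k. (\<Sum>i\<le>k. c i) * power_gap k w)"
    and "\<And>x. x > 0 \<Longrightarrow> summable (\<lambda>k. norm (\<Sum>i\<le>k. c i) * real_power_gap k x)"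
proof -
  have B': "norm (\<Sum>i\<le>k. c i) \<le> B" for k
    using B[of "Suc k"] by (simp add: lessThan_Suc_atMost)
  show sg: "summable (\<lambda>k. norm (\<Sum>i\<le>k. c i) * real_power_gap k x)" if "x > 0" for x
    by (rule summable_comparison_test'[OF summable_mult[OF summable_real_power_gap[OF that], of B], of 0])
      (use that B' in \<open>auto intro!: mult_right_mono simp: abs_mult real_power_gap_nonneg\<close>)
  fix w :: complex assume w: "Re w > 0"
  then have w0: "w \<noteq> 0" by auto
  have lim: "(\<lambda>N. (\<Sum>k<N. c k) * of_nat (Suc N) powr (- w)) \<longlonglongrightarrow> 0"
  proof (rule Lim_null_comparison)
    show "eventually (\<lambda>N. norm ((\<Sum>k<N. c k) * of_nat (Suc N) powr (- w)) \<le> B * real (Suc N) powr (- Re w)) sequentially"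
      by (intro always_eventually allI)
        (simp add: norm_mult norm_powr_of_nat mult_right_mono B del: of_nat_Suc)
    show "(\<lambda>N. B * real (Suc N) powr (- Re w)) \<longlonglongrightarrow> 0"
      by (rule tendsto_mult_right_zero) (use w in \<open>rule powr_neg_LIMSEQ_0\<close>)
  qed
  have "norm ((\<Sum>i\<le>k. c i) * power_gap k w) \<le> norm (\<Sum>i\<le>k. c i) * real_power_gap k (Re w)" for k
    using norm_power_gap_le[OF w, of w k] by (simp add: norm_mult mult_left_mono)
  then have "summable (\<lambda>k. (\<Sum>i\<le>k. c i) * power_gap k w)"
    by (intro summable_comparison_test'[OF sg[OF w], of 0]) auto
  then have "(\<lambda>k. (\<Sum>i\<le>k. c i) * power_gap k w) sums (\<Sum>k. (\<Sum>i\<le>k. c i) * power_gap k w)"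
    by (rule summable_sums)
  then have s: "(\<lambda>k. c k * of_nat (Suc k) powr (- w)) sums (w * (\<Sum>k. (\<Sum>i\<le>k. c i) * power_gap k w))"
    using abel_sums_power_gap_iff[OF w0 lim] by blast
  show "summable (\<lambda>k. c k * of_nat (Suc k) powr (- w))"
    using s by (rule sums_summable)
  show "(\<Sum>k. c k * of_nat (Suc k) powr (- w)) = w * (\<Sum>k. (\<Sum>i\<le>k. c i) * power_gap k w)"
    using s by (rule sums_unique[symmetric])
qed

section \<open>Euler products\<close>

text \<open>The sieve of Eratosthenes: by complete multiplicativity the remaining multiples of
  \<open>p\<close> contribute \<open>f p\<close> times the current sum, so the factor 1 - f p
  deletes exactly these.\<close>

lemma has_sum_sieve:
  fixes f :: "nat \<Rightarrow> complex"
  assumes mult: "\<And>m n. f (m * n) = f m * f n"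
    and L: "(f has_sum L) {0<..}"
    and F: "finite F" "\<And>p. p \<in> F \<Longrightarrow> prime p"
  shows "(f has_sum L * (\<Prod>p\<in>F. 1 - f p)) {n. n > 0 \<and> (\<forall>p\<in>F. \<not> p dvd n)}"
  using F
proof (induction F rule: finite_induct)
  case empty
  then show ?case using L by (simp add: greaterThan_def)
next
  case (insert p F)
  define A where "A = {n::nat. n > 0 \<and> (\<forall>p\<in>F. \<not> p dvd n)}"
  define l where "l = L * (\<Prod>p\<in>F. 1 - f p)"
  have p: "prime p" using insert by auto
  have IH: "(f has_sum l) A" using insert by (simp add: A_def l_def)
  have sub: "(\<lambda>n. p * n) ` A \<subseteq> A"
  proof clarify
    fix n assume n: "n \<in> A"
    have "\<not> r dvd p * n" if "r \<in> F" for r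
    proof -
      have "prime r" "r \<noteq> p" using insert.prems insert.hyps that by auto
      then have "\<not> r dvd p" using p by (auto dest: primes_dvd_imp_eq)
      then show ?thesis using \<open>prime r\<close> that n by (auto simp: A_def prime_dvd_mult_iff)
    qed
    then show "p * n \<in> A" using n prime_gt_0_nat[OF p] by (simp add: A_def)
  qed
  have "inj_on (\<lambda>n. p * n) A" using prime_gt_0_nat[OF p] by (auto simp: inj_on_def)
  then have "(f has_sum f p * l) ((\<lambda>n. p * n) ` A)"
    using has_sum_cmult_right[OF IH, of "f p"] by (subst has_sum_reindex) (auto simp: o_def mult)
  then have "(f has_sum l - f p * l) (A - (\<lambda>n. p * n) ` A)"
    using IH sub by (intro has_sum_Diff)
  moreover have "A - (\<lambda>n. p * n) ` A = {n. n > 0 \<and> (\<forall>r\<in>insert p F. \<not> r dvd n)}"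
  proof -
    have "n \<in> (\<lambda>n. p * n) ` A" if "n \<in> A" "p dvd n" for n
    proof -
      obtain m where m: "n = p * m" using \<open>p dvd n\<close> by (rule dvdE)
      then have "m \<in> A" using that by (auto simp: A_def)
      with m show ?thesis by blast
    qed
    then show ?thesis by (auto simp: A_def)
  qed
  moreover have "l - f p * l = L * (\<Prod>p\<in>insert p F. 1 - f p)"
    using insert.hyps by (simp add: l_def algebra_simps)
  ultimately show ?case by simp
qed

text \<open>After sieving by the primes below \<open>N\<close>, only 1 and integers at least
  \<open>N\<close> can survive, so the error is at most a tail of the absolutely convergent series.
  Keeping the factors next to the series avoids dividing by them.\<close>

lemma euler_product_LIMSEQ:
  fixes f :: "nat \<Rightarrow> complex"
  assumes mult: "\<And>m n. f (m * n) = f m * f n" and f1: "f 1 = 1"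
    and sm: "summable (\<lambda>n. norm (f (Suc n)))"
  shows "(\<lambda>N. (\<Sum>n. f (Suc n)) * (\<Prod>p | prime p \<and> p < N. 1 - f p)) \<longlonglongrightarrow> 1"
proof -
  define L where "L = (\<Sum>n. f (Suc n))"
  define T where "T = (\<Sum>n. norm (f (Suc n)))"
  have bij: "bij_betw Suc UNIV {0<..}"
    by (simp add: bij_betw_def greaterThan_0)
  have "((\<lambda>n. f (Suc n)) has_sum L) UNIV"
    unfolding L_def using sm by (intro norm_summable_imp_has_sum summable_sums summable_norm_cancel[OF sm])
  then have L: "(f has_sum L) {0<..}"
    using has_sum_reindex_bij_betw[OF bij, of f] by simp
  have "((\<lambda>n. norm (f (Suc n))) has_sum T) UNIV"
    unfolding T_def using sm by (intro norm_summable_imp_has_sum summable_sums) auto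
  then have T: "((\<lambda>n. norm (f n)) has_sum T) {0<..}"
    using has_sum_reindex_bij_betw[OF bij, of "\<lambda>n. norm (f n)"] by simp
  \<comment> \<open>Because of the shift by \<open>Suc\<close>, the sum over n < N-1 covers the
    integers from 1 to N-1.\<close>
  have bound: "norm (L * (\<Prod>p | prime p \<and> p < N. 1 - f p) - 1) \<le> T - (\<Sum>n<N-1. norm (f (Suc n)))" for N
  proof -
    define A where "A = {n::nat. n > 0 \<and> (\<forall>p\<in>{p. prime p \<and> p < N}. \<not> p dvd n)}"
    have "(f has_sum (L * (\<Prod>p | prime p \<and> p < N. 1 - f p))) A"
      unfolding A_def by (rule has_sum_sieve[OF mult L]) auto
    moreover have "(f has_sum 1) {1}" using f1 by (intro has_sum_finiteI) auto
    moreover have "{1} \<subseteq> A" by (auto simp: A_def)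
    ultimately have d: "(f has_sum (L * (\<Prod>p | prime p \<and> p < N. 1 - f p) - 1)) (A - {1})"
      by (rule has_sum_Diff)
    have A1: "n \<ge> N" if n: "n \<in> A - {1}" for n
    proof (rule ccontr)
      assume "\<not> n \<ge> N"
      obtain p where p: "prime p" "p dvd n" using n prime_factor_nat[of n] by auto
      have "p \<le> n" using p n by (auto simp: A_def intro: dvd_imp_le)
      then show False using n p \<open>\<not> n \<ge> N\<close> by (auto simp: A_def)
    qed
    have S: "(\<lambda>n. norm (f n)) summable_on {0<..}" using T by (rule has_sum_imp_summable)
    have "(\<lambda>n. norm (f n)) summable_on A - {1}"
      by (rule summable_on_subset[OF S]) (auto simp: A_def)
    then have d': "((\<lambda>n. norm (f n)) has_sum (\<Sum>\<^sub>\<infinity>n\<in>A - {1}. norm (f n))) (A - {1})"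
      by (rule has_sum_infsum)
    moreover have "((\<lambda>n. norm (f n)) has_sum (\<Sum>n\<in>{1..<N}. norm (f n))) {1..<N}"
      by (intro has_sum_finiteI) auto
    ultimately have "((\<lambda>n. norm (f n)) has_sum ((\<Sum>\<^sub>\<infinity>n\<in>A - {1}. norm (f n)) + (\<Sum>n\<in>{1..<N}. norm (f n)))) ((A - {1}) \<union> {1..<N})"
      by (rule has_sum_Un_disjoint) (use A1 in force)
    then have "(\<Sum>\<^sub>\<infinity>n\<in>A - {1}. norm (f n)) + (\<Sum>n\<in>{1..<N}. norm (f n)) \<le> T"
      by (rule has_sum_mono_neutral[OF _ T]) (auto simp: A_def)
    moreover have "norm (L * (\<Prod>p | prime p \<and> p < N. 1 - f p) - 1) \<le> (\<Sum>\<^sub>\<infinity>n\<in>A - {1}. norm (f n))"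
      using d d' by (rule norm_has_sum_bound[rotated])
    moreover have "(\<Sum>n\<in>{1..<N}. norm (f n)) = (\<Sum>n<N-1. norm (f (Suc n)))"
      by (rule sum.reindex_bij_witness[of _ Suc "\<lambda>n. n - 1"]) auto
    ultimately show ?thesis by simp
  qed
  have "(\<lambda>N. T - (\<Sum>n<N-1. norm (f (Suc n)))) \<longlonglongrightarrow> T - T"
  proof (intro tendsto_diff tendsto_const)
    have "(\<lambda>N. \<Sum>n<N. norm (f (Suc n))) \<longlonglongrightarrow> T"
      unfolding T_def using sm by (rule summable_LIMSEQ)
    then show "(\<lambda>N. \<Sum>n<N-1. norm (f (Suc n))) \<longlonglongrightarrow> T"
      by (subst filterlim_sequentially_Suc[symmetric]) simp
  qed
  then have "(\<lambda>N. L * (\<Prod>p | prime p \<and> p < N. 1 - f p) - 1) \<longlonglongrightarrow> 0"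
    using Lim_null_comparison[OF always_eventually[OF allI[OF bound]]] by simp
  then show ?thesis unfolding L_def[symmetric] by (simp only: LIM_zero_iff)
qed

text \<open>Note that \<open>weierstrass_factor 1 z = (1 - z) * exp z = 1 + O(z\<^sup>2)\<close>.\<close>
definition euler_factor :: "(nat \<Rightarrow> complex) \<Rightarrow> nat \<Rightarrow> complex \<Rightarrow> complex" where
  "euler_factor chi n s = (if prime n then weierstrass_factor 1 (chi n * of_nat n powr (- s)) else 1)"

definition euler_correction :: "(nat \<Rightarrow> complex) \<Rightarrow> complex \<Rightarrow> complex" where
  "euler_correction chi s = (\<Prod>n. euler_factor chi n s)"

text \<open>From n = 4 on, the argument has modulus at most 4^(-1/2) = 1/2, the range of
  \<open>weierstrass_factor_bound\<close>, which supplies the 3. The bound is summable because 2y >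
  1: this is where 1/2 enters.\<close>

lemma euler_factor_bound:
  assumes chi: "norm (chi n) \<le> 1" and y: "y > 1/2" "y \<le> Re s" and n: "n \<ge> 4"
  shows "norm (euler_factor chi n s - 1) \<le> 3 * real n powr (- 2 * y)"
proof (cases "prime n")
  case True
  define z where "z = chi n * of_nat n powr (- s)"
  have "norm z \<le> 1 * real n powr (- Re s)"
    unfolding z_def norm_mult by (intro mult_mono chi norm_powr_of_nat_le) auto
  also have "real n powr (- Re s) \<le> real n powr (- y)"
    using n y by (intro powr_mono) auto
  finally have z: "norm z \<le> real n powr (- y)" by simp
  also have "\<dots> \<le> real n powr (- (1/2))" using n y by (intro powr_mono) auto
  also have "\<dots> \<le> 4 powr (- (1/2))" using n by (intro powr_mono2') auto
  also have "(4::real) powr (- (1/2)) = 1/2" by (simp add: powr_minus powr_half_sqrt)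
  finally have "norm (weierstrass_factor 1 z - 1) \<le> 3 * norm z ^ Suc 1"
    by (rule weierstrass_factor_bound)
  also have "norm z ^ Suc 1 \<le> (real n powr (- y)) ^ Suc 1" using z by (intro power_mono) auto
  also have "(real n powr (- y)) ^ Suc 1 = real n powr (- 2 * y)"
    using n by (simp add: powr_add[symmetric])
  finally show ?thesis using True by (simp add: euler_factor_def z_def)
qed (auto simp: euler_factor_def)

lemma summable_powr_minus_double: "y > 1/2 \<Longrightarrow> summable (\<lambda>n. 3 * real n powr (- 2 * y))"
  by (intro summable_mult) (simp add: summable_real_powr_iff)

lemma euler_factor_convergent_prod:
  assumes chi: "\<And>n. norm (chi n) \<le> 1" and s: "Re s > 1/2"
  shows "convergent_prod (\<lambda>n. euler_factor chi n s)"
proof (rule abs_convergent_prod_imp_convergent_prod, rule summable_imp_abs_convergent_prod)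
  show "summable (\<lambda>n. norm (euler_factor chi n s - 1))"
    by (rule summable_comparison_test'[OF summable_powr_minus_double[OF s], of 4])
       (use euler_factor_bound[OF chi s] in auto)
qed

text \<open>A convergent product vanishes only with a factor, and a factor only if chi(p) p^(-s) =
  1, impossible since this number has modulus below 1.\<close>

lemma euler_correction_nonzero:
  assumes chi: "\<And>n. norm (chi n) \<le> 1" and s: "Re s > 1/2"
  shows "euler_correction chi s \<noteq> 0"
  unfolding euler_correction_def
proof (rule prodinf_nonzero[OF euler_factor_convergent_prod[OF assms]])
  fix n
  show "euler_factor chi n s \<noteq> 0"
  proof (cases "prime n")
    case True
    then have n: "n > 1" by (rule prime_gt_1_nat)
    have "norm (chi n * of_nat n powr (- s)) \<le> 1 * real n powr (- Re s)"
      unfolding norm_mult by (intro mult_mono chi norm_powr_of_nat_le) auto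
    also have "real n powr (- Re s) < 1 powr (- Re s)"
      using n s by (intro powr_less_mono2_neg) auto
    finally have "chi n * of_nat n powr (- s) \<noteq> 1" by auto
    then show ?thesis using True by (simp add: euler_factor_def)
  qed (simp add: euler_factor_def)
qed

lemma euler_factor_holomorphic: "euler_factor chi n holomorphic_on S"
proof (cases "prime n")
  case True
  then have "n > 0" by (rule prime_gt_0_nat)
  with True show ?thesis
    unfolding euler_factor_def[abs_def] by (auto intro!: holomorphic_intros)
qed (simp add: euler_factor_def[abs_def])

lemma euler_correction_holomorphic:
  assumes chi: "\<And>n. norm (chi n) \<le> 1"
  shows "euler_correction chi holomorphic_on {s. 1/2 < Re s}"
proof (rule holomorphic_uniform_sequence[where f = "\<lambda>N s. \<Prod>n<N. euler_factor chi n s"])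
  show "open {s. 1/2 < Re s}" by (rule open_halfspace_Re_gt)
  show "(\<lambda>s. \<Prod>n<N. euler_factor chi n s) holomorphic_on {s. 1/2 < Re s}" for N
    by (intro holomorphic_intros euler_factor_holomorphic)
  fix s assume s: "s \<in> {s. 1/2 < Re s}"
  define d where "d = (Re s - 1/2) / 2"
  have d: "d > 0" using s by (simp add: d_def)
  have sub: "1/2 + d \<le> Re z" if "z \<in> cball s d" for z
  proof -
    have "\<bar>Re s - Re z\<bar> \<le> d" using that abs_Re_le_cmod[of "s - z"] by (simp add: dist_norm)
    moreover have "1/2 + d = Re s - d" by (simp add: d_def field_simps)
    ultimately show ?thesis by linarith
  qed
  have "uniformly_convergent_on (cball s d) (\<lambda>N s. \<Prod>n<N. euler_factor chi n s)"
  proof (rule uniformly_convergent_on_prod')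
    show "continuous_on (cball s d) (euler_factor chi n)" for n
      by (rule holomorphic_on_imp_continuous_on[OF euler_factor_holomorphic])
    show "uniformly_convergent_on (cball s d) (\<lambda>N x. \<Sum>n<N. norm (euler_factor chi n x - 1))"
    proof (rule Weierstrass_m_test'_ev)
      show "eventually (\<lambda>n. \<forall>x\<in>cball s d. norm (norm (euler_factor chi n x - 1)) \<le> 3 * real n powr (- 2 * (1/2 + d))) sequentially"
        using eventually_ge_at_top[of 4]
      proof eventually_elim
        case (elim n)
        have "norm (euler_factor chi n x - 1) \<le> 3 * real n powr (- 2 * (1/2 + d))" if "x \<in> cball s d" for x
          by (rule euler_factor_bound[OF chi _ sub[OF that] elim]) (use d in auto)
        then show ?case by simp
      qed
    qed (use summable_powr_minus_double[of "1/2 + d"] d in auto)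
  qed auto
  then obtain g where g: "uniform_limit (cball s d) (\<lambda>N s. \<Prod>n<N. euler_factor chi n s) g sequentially"
    by (auto simp: uniformly_convergent_on_def)
  have "g z = euler_correction chi z" if z: "z \<in> cball s d" for z
  proof -
    have "(\<lambda>N. \<Prod>n<N. euler_factor chi n z) \<longlonglongrightarrow> g z"
      using g z by (rule tendsto_uniform_limitI)
    moreover have "(\<lambda>N. \<Prod>n<N. euler_factor chi n z) \<longlonglongrightarrow> euler_correction chi z"
      using convergent_prod_LIMSEQ[OF euler_factor_convergent_prod[OF chi, of z]] sub[OF z] d
      by (simp add: LIMSEQ_lessThan_iff_atMost euler_correction_def)
    ultimately show ?thesis by (rule LIMSEQ_unique)
  qed
  then have "uniform_limit (cball s d) (\<lambda>N s. \<Prod>n<N. euler_factor chi n s) (euler_correction chi) sequentially"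
    using g by (metis (no_types, lifting) uniform_limit_cong')
  then show "\<exists>d>0. cball s d \<subseteq> {s. 1/2 < Re s} \<and>
      uniform_limit (cball s d) (\<lambda>N s. \<Prod>n<N. euler_factor chi n s) (euler_correction chi) sequentially"
    using d sub by (intro exI[of _ d]) force
qed

text \<open>Truncated Euler products times exponentials of truncated prime sums are exactly the
  truncated products of \<open>euler_correction\<close>. The limit is taken on these exponentials,
  so no branch of a logarithm is chosen.\<close>

lemma L_times_euler_correction:
  assumes mult: "\<And>m n. chi (m * n) = chi m * chi n" and chi1: "chi 1 = 1"
    and chi: "\<And>n. norm (chi n) \<le> 1" and s: "Re s > 1"
  shows "summable (\<lambda>n. if prime n then chi n * of_nat n powr (- s) else 0)"
    and "(\<Sum>k. L_term chi s k) * euler_correction chi s =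
      exp (\<Sum>n. if prime n then chi n * of_nat n powr (- s) else 0)"
proof -
  define f where "f n = chi n * of_nat n powr (- s)" for n
  have fmult: "f (m * n) = f m * f n" for m n
  proof -
    have "of_nat (m * n) powr (- s) = of_nat m powr (- s) * (of_nat n :: complex) powr (- s)"
      by (simp add: powr_times_real)
    then show ?thesis by (simp add: f_def mult)
  qed
  have fb: "norm (f n) \<le> real n powr (- Re s)" for n
  proof -
    have "norm (f n) \<le> 1 * real n powr (- Re s)"
      unfolding f_def norm_mult by (intro mult_mono chi norm_powr_of_nat_le) auto
    then show ?thesis by simp
  qed
  have sp: "summable (\<lambda>n. real n powr (- Re s))" using s by (simp add: summable_real_powr_iff)
  have nf: "summable (\<lambda>n. norm (f n))"
    by (rule summable_comparison_test'[OF sp, of 0]) (use fb in auto)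
  have "norm (if prime n then f n else 0) \<le> real n powr (- Re s)" for n
    using fb by auto
  then show P: "summable (\<lambda>n. if prime n then chi n * of_nat n powr (- s) else 0)"
    unfolding f_def by (intro summable_comparison_test'[OF sp, of 0]) auto
  define L where "L = (\<Sum>n. f (Suc n))"
  have "(\<lambda>N. L * (\<Prod>p | prime p \<and> p < N. 1 - f p)) \<longlonglongrightarrow> 1"
    unfolding L_def
  proof (rule euler_product_LIMSEQ[OF fmult])
    show "f 1 = 1" using chi1 by (simp add: f_def)
    show "summable (\<lambda>n. norm (f (Suc n)))" using nf by (subst summable_Suc_iff)
  qed
  moreover have "(\<lambda>N. exp (\<Sum>n<N. if prime n then f n else 0)) \<longlonglongrightarrow> exp (\<Sum>n. if prime n then f n else 0)"
    using P unfolding f_def by (intro tendsto_exp summable_LIMSEQ)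
  ultimately have "(\<lambda>N. L * (\<Prod>p | prime p \<and> p < N. 1 - f p) * exp (\<Sum>n<N. if prime n then f n else 0))
      \<longlonglongrightarrow> 1 * exp (\<Sum>n. if prime n then f n else 0)"
    by (rule tendsto_mult)
  moreover have "L * (\<Prod>p | prime p \<and> p < N. 1 - f p) * exp (\<Sum>n<N. if prime n then f n else 0) =
      L * (\<Prod>n<N. euler_factor chi n s)" for N
  proof -
    have "(\<Prod>p | prime p \<and> p < N. 1 - f p) = (\<Prod>n<N. if prime n then 1 - f n else 1)"
      by (rule prod.mono_neutral_cong_left) auto
    then have "(\<Prod>p | prime p \<and> p < N. 1 - f p) * exp (\<Sum>n<N. if prime n then f n else 0)
      = (\<Prod>n<N. (if prime n then 1 - f n else 1) * exp (if prime n then f n else 0))"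
      by (simp add: exp_sum prod.distrib)
    also have "\<dots> = (\<Prod>n<N. euler_factor chi n s)"
      by (intro prod.cong) (auto simp: euler_factor_def weierstrass_factor_def f_def)
    finally show ?thesis by (simp add: mult.assoc)
  qed
  ultimately have "(\<lambda>N. L * (\<Prod>n<N. euler_factor chi n s)) \<longlonglongrightarrow> exp (\<Sum>n. if prime n then f n else 0)"
    by simp
  moreover have "(\<lambda>N. L * (\<Prod>n<N. euler_factor chi n s)) \<longlonglongrightarrow> L * euler_correction chi s"
    using convergent_prod_LIMSEQ[OF euler_factor_convergent_prod[OF chi, of s]] s
    by (intro tendsto_mult tendsto_const) (simp add: LIMSEQ_lessThan_iff_atMost euler_correction_def)
  ultimately have "L * euler_correction chi s = exp (\<Sum>n. if prime n then f n else 0)"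
    using LIMSEQ_unique by blast
  moreover have "L = (\<Sum>k. L_term chi s k)"
    unfolding L_def L_term_def f_def ..
  ultimately show "(\<Sum>k. L_term chi s k) * euler_correction chi s =
      exp (\<Sum>n. if prime n then chi n * of_nat n powr (- s) else 0)"
    unfolding f_def by simp
qed

section \<open>Dirichlet characters\<close>

lemma dirichlet_character_1:
  assumes "dirichlet_character q chi" shows "chi 1 = 1"
proof -
  have "chi 1 * chi 1 = chi 1" "chi 1 \<noteq> 0"
    using assms unfolding dirichlet_character_def by (metis mult_1, metis coprime_1_left)
  then show ?thesis by simp
qed

lemma dirichlet_character_mod:
  assumes "dirichlet_character q chi" shows "chi (n mod q) = chi n"
proof -
  have "chi (m + k * q) = chi m" for m k
  proof (induction k)
    case (Suc k)
    have "m + Suc k * q = (m + k * q) + q" by simp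
    then show ?case using assms Suc by (simp only: dirichlet_character_def)
  qed simp
  from this[of "n mod q" "n div q"] show ?thesis by simp
qed

lemma dirichlet_character_power:
  assumes "dirichlet_character q chi" shows "chi (n ^ k) = chi n ^ k"
  using dirichlet_character_1[OF assms] assms
  by (induction k) (auto simp: dirichlet_character_def)

text \<open>By Euler's theorem the value is a root of unity.\<close>

lemma dirichlet_character_norm:
  assumes chi: "dirichlet_character q chi" and n: "coprime n q" shows "norm (chi n) = 1"
proof -
  have q: "q > 0" using chi by (simp add: dirichlet_character_def)
  have "[n ^ totient q = 1] (mod q)" using n by (rule euler_theorem)
  then have "chi (n ^ totient q) = chi 1"
    by (metis cong_def dirichlet_character_mod[OF chi])
  then have "norm (chi n) ^ totient q = 1"
    using dirichlet_character_1[OF chi] dirichlet_character_power[OF chi]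
    by (metis norm_one norm_power)
  then show ?thesis using q power_eq_imp_eq_base[of "norm (chi n)" "totient q" 1] by simp
qed

lemma dirichlet_character_norm_le:
  assumes "dirichlet_character q chi" shows "norm (chi n) \<le> 1"
  using dirichlet_character_norm[OF assms, of n] assms
  by (cases "coprime n q") (auto simp: dirichlet_character_def)

lemma real_dirichlet_character_values:
  assumes chi: "dirichlet_character q chi" and "real_character chi"
  shows "Re (chi n) \<in> {- 1, 0, 1}"
proof -
  have r: "chi n = of_real (Re (chi n))"
    using assms(2) by (simp add: real_character_def complex_is_Real_iff complex_eq_iff)
  show ?thesis
  proof (cases "coprime n q")
    case True
    have "\<bar>Re (chi n)\<bar> = 1"
      using dirichlet_character_norm[OF chi True] by (subst (asm) r) simp
    then show ?thesis by auto
  next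
    case False
    then have "chi n = 0" using chi unfolding dirichlet_character_def by blast
    then show ?thesis by simp
  qed
qed

text \<open>Multiplication by a coprime residue \<open>a\<close> with chi(a) different from 1
  permutes the residues, so the sum equals chi(a) times itself.\<close>

lemma dirichlet_character_sum_period:
  assumes chi: "dirichlet_character q chi" and np: "chi \<noteq> principal_character q"
  shows "(\<Sum>n<q. chi n) = 0"
proof -
  obtain a where a: "chi a \<noteq> principal_character q a" using np by auto
  then have cop: "coprime a q" and a1: "chi a \<noteq> 1"
    using chi by (auto simp: principal_character_def dirichlet_character_def split: if_splits)
  have q: "q > 0" using chi by (simp add: dirichlet_character_def)
  have inj: "inj_on (\<lambda>n. (a * n) mod q) {..<q}"
  proof (rule inj_onI)
    fix x y assume xy: "x \<in> {..<q}" "y \<in> {..<q}" "(a * x) mod q = (a * y) mod q"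
    then have "[x = y] (mod q)" using cop by (simp add: cong_def[symmetric] cong_mult_lcancel_nat)
    then show "x = y" using xy by (simp add: cong_def)
  qed
  have "(\<lambda>n. (a * n) mod q) ` {..<q} = {..<q}"
    by (rule endo_inj_surj[OF _ _ inj]) (use q in auto)
  then have "(\<Sum>n<q. chi n) = (\<Sum>n<q. chi ((a * n) mod q))"
    using sum.reindex[OF inj, of chi] by simp
  also have "\<dots> = chi a * (\<Sum>n<q. chi n)"
    using chi by (simp add: dirichlet_character_mod[OF chi] sum_distrib_left dirichlet_character_def)
  finally show ?thesis using a1 by simp
qed

lemma dirichlet_character_partial_sum_bound:
  assumes chi: "dirichlet_character q chi" and np: "chi \<noteq> principal_character q"
  shows "norm (\<Sum>k<n. chi k) \<le> real q"
proof (induction n rule: less_induct)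
  case (less n)
  have q: "q > 0" using chi by (simp add: dirichlet_character_def)
  show ?case
  proof (cases "n < q")
    case True
    have "norm (\<Sum>k<n. chi k) \<le> (\<Sum>k<n. 1)"
      by (rule sum_norm_le) (simp add: dirichlet_character_norm_le[OF chi])
    then show ?thesis using True by simp
  next
    case False
    then obtain m where m: "n = m + q" by (metis add.commute le_Suc_ex not_less)
    have "(\<Sum>k<m + q. chi k) = (\<Sum>k<q. chi k) + (\<Sum>k<m. chi (k + q))"
      by (induction m) (simp_all add: add.assoc)
    also have "\<dots> = (\<Sum>k<m. chi k)"
      using chi dirichlet_character_sum_period[OF assms] by (simp add: dirichlet_character_def)
    finally show ?thesis using less.IH[of m] m q by simp
  qed
qed

text \<open>The L-series starts at 1; leaving out \<open>chi 0\<close> costs the extra 1.\<close>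

lemma dirichlet_character_partial_sum_Suc_bound:
  assumes "dirichlet_character q chi" and "chi \<noteq> principal_character q"
  shows "norm (\<Sum>k<n. chi (Suc k)) \<le> real q + 1"
proof -
  have "(\<Sum>k<n. chi (Suc k)) = (\<Sum>k<Suc n. chi k) - chi 0"
    by (simp add: sum.lessThan_Suc_shift del: sum.lessThan_Suc)
  then have "norm (\<Sum>k<n. chi (Suc k)) \<le> norm (\<Sum>k<Suc n. chi k) + norm (chi 0)"
    by (simp only: norm_triangle_ineq4)
  then show ?thesis
    using dirichlet_character_partial_sum_bound[OF assms, of "Suc n"]
      dirichlet_character_norm_le[OF assms(1), of 0] by linarith
qed

section \<open>Non-vanishing at 1\<close>

text \<open>A divisor of p^k m is uniquely a power of \<open>p\<close> times a divisor of
  \<open>m\<close>. This splits the local factor at \<open>p\<close> off the convolution of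
  \<open>f\<close> with the constant 1.\<close>

lemma sum_divisors_prime_power:
  fixes f :: "nat \<Rightarrow> real"
  assumes mult: "\<And>m n. f (m * n) = f m * f n" and f1: "f 1 = 1"
    and p: "prime p" "\<not> p dvd m"
  shows "(\<Sum>d | d dvd p ^ k * m. f d) = (\<Sum>i\<le>k. f p ^ i) * (\<Sum>d | d dvd m. f d)"
proof -
  have fp: "f (p ^ i) = f p ^ i" for i by (induction i) (use f1 in \<open>simp_all add: mult\<close>)
  have le: "i \<le> j" if "p ^ i * d = p ^ j * e" "\<not> p dvd d" "\<not> p dvd e" for i j d e
  proof (rule ccontr)
    assume "\<not> i \<le> j"
    then have "p ^ i = p ^ j * p ^ (i - j)" by (simp add: power_add[symmetric])
    then have "p ^ (i - j) * d = e" using that(1) prime_gt_0_nat[OF p(1)] by simp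
    moreover have "p dvd p ^ (i - j)" using \<open>\<not> i \<le> j\<close> by simp
    ultimately show False using that(3) by auto
  qed
  have nd: "\<not> p dvd d" if "d dvd m" for d using that p(2) dvd_trans by blast
  have "bij_betw (\<lambda>(i, d). p ^ i * d) ({..k} \<times> {d. d dvd m}) {d. d dvd p ^ k * m}"
  proof (rule bij_betw_imageI)
    show "inj_on (\<lambda>(i, d). p ^ i * d) ({..k} \<times> {d. d dvd m})"
    proof (rule inj_onI, clarify)
      fix i d j e assume *: "d dvd m" "e dvd m" "p ^ i * d = p ^ j * e"
      have "i = j" using le[OF *(3)] le[OF *(3)[symmetric]] nd * by (meson antisym)
      then show "i = j \<and> d = e" using * prime_gt_0_nat[OF p(1)] by simp
    qed
    show "(\<lambda>(i, d). p ^ i * d) ` ({..k} \<times> {d. d dvd m}) = {d. d dvd p ^ k * m}"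
    proof (intro equalityI subsetI)
      fix x assume "x \<in> (\<lambda>(i, d). p ^ i * d) ` ({..k} \<times> {d. d dvd m})"
      then show "x \<in> {d. d dvd p ^ k * m}" by (auto intro: mult_dvd_mono le_imp_power_dvd)
    next
      fix x assume "x \<in> {d. d dvd p ^ k * m}"
      then have "x dvd p ^ k * m" by simp
      then obtain y d where yd: "x = y * d" "y dvd p ^ k" "d dvd m"
        by (rule dvd_productE)
      then obtain i where "i \<le> k" "y = p ^ i" using divides_primepow_nat[OF p(1)] by blast
      then show "x \<in> (\<lambda>(i, d). p ^ i * d) ` ({..k} \<times> {d. d dvd m})" using yd by force
    qed
  qed
  then have "(\<Sum>d | d dvd p ^ k * m. f d) = (\<Sum>x\<in>{..k} \<times> {d. d dvd m}. f (case x of (i, d) \<Rightarrow> p ^ i * d))"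
    by (rule sum.reindex_bij_betw[symmetric])
  also have "\<dots> = (\<Sum>(i, d)\<in>{..k} \<times> {d. d dvd m}. f p ^ i * f d)"
    by (intro sum.cong) (auto simp: mult fp)
  finally show ?thesis by (simp add: sum_product sum.cartesian_product)
qed

text \<open>The local factor 1 + f(p) + ... + f(p)^k equals k+1, or 1, or alternates between 1 and
  0. It is never negative, and at least 1 for even \<open>k\<close>, the only exponents occurring in
  a square.\<close>

lemma sum_divisors_nonneg:
  fixes f :: "nat \<Rightarrow> real"
  assumes mult: "\<And>m n. f (m * n) = f m * f n" and f1: "f 1 = 1"
    and vals: "\<And>n. f n \<in> {- 1, 0, 1}" and n: "n > 0"
  shows "(\<Sum>d | d dvd n. f d) \<ge> 0 \<and> (\<Sum>d | d dvd n\<^sup>2. f d) \<ge> 1"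
  using n
proof (induction n rule: less_induct)
  case (less n)
  have minus: "(\<Sum>i\<le>k. (- 1) ^ i :: real) = (if even k then 1 else 0)" for k
    by (induction k) auto
  have geo: "(\<Sum>i\<le>k. f p ^ i) \<ge> 0 \<and> (\<Sum>i\<le>2 * k. f p ^ i) \<ge> 1" for p k
    using vals[of p] minus[of k] minus[of "2 * k"] by (auto simp: power_0_left)
  show ?case
  proof (cases "n = 1")
    case True
    then show ?thesis using f1 by simp
  next
    case False
    then obtain p where p: "prime p" "p dvd n" using prime_factor_nat by blast
    obtain k m where km: "\<not> p dvd m" "n = p ^ k * m"
      using prime_power_canonical[OF p(1) less.prems] by (metis mult.commute)
    have "m > 0" using km less.prems by (cases m) auto
    have "k > 0" using km p by (cases k) auto
    then have "p ^ k > 1" using prime_gt_1_nat[OF p(1)] by (rule one_less_power[rotated])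
    then have "m < n" using km \<open>m > 0\<close> by simp
    then have IH: "(\<Sum>d | d dvd m. f d) \<ge> 0" "(\<Sum>d | d dvd m\<^sup>2. f d) \<ge> 1"
      using less.IH \<open>m > 0\<close> by auto
    have "n\<^sup>2 = p ^ (2 * k) * m\<^sup>2"
      unfolding km(2) by (simp add: power_mult_distrib power_mult[symmetric] mult.commute)
    moreover have "\<not> p dvd m\<^sup>2" using km(1) p(1) prime_dvd_power by blast
    ultimately have "(\<Sum>d | d dvd n\<^sup>2. f d) = (\<Sum>i\<le>2 * k. f p ^ i) * (\<Sum>d | d dvd m\<^sup>2. f d)"
      using sum_divisors_prime_power[OF mult f1 p(1)] by simp
    moreover have "(\<Sum>d | d dvd n. f d) = (\<Sum>i\<le>k. f p ^ i) * (\<Sum>d | d dvd m. f d)"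
      using sum_divisors_prime_power[OF mult f1 p(1) km(1)] km(2) by simp
    moreover have "1 * 1 \<le> (\<Sum>i\<le>2 * k. f p ^ i) * (\<Sum>d | d dvd m\<^sup>2. f d)"
      using geo IH(2) by (intro mult_mono) (auto intro: order_trans[of 0 1])
    ultimately show ?thesis using IH(1) geo by simp
  qed
qed

text \<open>Expanding t^n / (1 - t^n) geometrically and collecting the pairs with nm = N gives a
  power series whose coefficients are the divisor sums. Keeping only finitely many squares N leaves
  the lower bound.\<close>

lemma lambert_series_ge:
  fixes f :: "nat \<Rightarrow> real"
  assumes mult: "\<And>m n. f (m * n) = f m * f n" and f1: "f 1 = 1"
    and vals: "\<And>n. f n \<in> {- 1, 0, 1}" and t: "0 < t" "t < 1"
  obtains S where "(\<lambda>n. f (Suc n) * (t ^ Suc n / (1 - t ^ Suc n))) sums S"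
    "\<And>K. S \<ge> (\<Sum>k=1..K. t ^ (k\<^sup>2))"
proof -
  have fb: "\<bar>f n\<bar> \<le> 1" for n using vals[of n] by auto
  have bij: "bij_betw Suc UNIV {0<..}" by (simp add: bij_betw_def greaterThan_0)
  have geo: "((\<lambda>m. t ^ (n * m)) has_sum t ^ n / (1 - t ^ n)) {0<..}" if "n > 0" for n
  proof -
    have tn: "norm (t ^ n) < 1" using t that by (simp add: power_less_one_iff)
    have "(\<lambda>m. t ^ n * (t ^ n) ^ m) sums (t ^ n * (1 / (1 - t ^ n)))"
      by (intro sums_mult geometric_sums tn)
    then have "(\<lambda>m. t ^ (n * Suc m)) sums (t ^ n / (1 - t ^ n))"
      by (simp add: power_add power_mult)
    then have "((\<lambda>m. t ^ (n * Suc m)) has_sum (t ^ n / (1 - t ^ n))) UNIV"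
      using t by (intro norm_summable_imp_has_sum) (auto intro: sums_summable)
    then show ?thesis
      using has_sum_reindex_bij_betw[OF bij, of "\<lambda>m. t ^ (n * m)"] by simp
  qed
  have inner_sum: "(\<lambda>n. t ^ n / (1 - t ^ n)) summable_on {0<..}"
  proof -
    have "(\<lambda>n. t ^ n) summable_on {0<..}"
      using has_sum_imp_summable[OF geo[of 1]] by simp
    then have g: "(\<lambda>n. t ^ n * (1 / (1 - t))) summable_on {0<..}"
      by (rule summable_on_cmult_left)
    have "norm (t ^ n / (1 - t ^ n)) \<le> t ^ n * (1 / (1 - t))" if "n \<in> {0<..}" for n
    proof -
      have "t ^ n \<le> t ^ 1" using t that by (intro power_decreasing) auto
      then have "t ^ n / (1 - t ^ n) \<le> t ^ n / (1 - t)"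
        using t by (intro divide_left_mono) auto
      then show ?thesis using t \<open>t ^ n \<le> t ^ 1\<close> by simp
    qed
    then have "(\<lambda>n. norm (t ^ n / (1 - t ^ n))) summable_on {0<..}"
      by (rule Infinite_Sum.abs_summable_on_comparison_test'[OF g])
    then show ?thesis by (rule abs_summable_summable)
  qed
  define g where "g = (\<lambda>(n, m). f n * t ^ (n * m))"
  have "(\<lambda>(n, m). t ^ (n * m)) summable_on {0<..} \<times> {0<..}"
    by (rule summable_on_SigmaI[OF _ inner_sum]) (use geo t in auto)
  then have "(\<lambda>x. norm (g x)) summable_on {0<..} \<times> {0<..}"
  proof (rule Infinite_Sum.abs_summable_on_comparison_test')
    fix x :: "nat \<times> nat"
    show "norm (g x) \<le> (case x of (n, m) \<Rightarrow> t ^ (n * m))"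
      using t fb by (cases x) (auto simp: g_def abs_mult mult_left_le_one_le)
  qed
  then have "g summable_on {0<..} \<times> {0<..}" by (rule abs_summable_summable)
  then obtain S where S: "(g has_sum S) ({0<..} \<times> {0<..})" by (auto simp: summable_on_def)
  show thesis
  proof
    have "((\<lambda>n. f n * (t ^ n / (1 - t ^ n))) has_sum S) {0<..}"
    proof (rule has_sum_SigmaD[OF S])
      fix n :: nat assume "n \<in> {0<..}"
      then show "((\<lambda>m. g (n, m)) has_sum f n * (t ^ n / (1 - t ^ n))) {0<..}"
        using has_sum_cmult_right[OF geo[of n], of "f n"] by (simp add: g_def)
    qed
    then have "((\<lambda>n. f (Suc n) * (t ^ Suc n / (1 - t ^ Suc n))) has_sum S) UNIV"
      using has_sum_reindex_bij_betw[OF bij, of "\<lambda>n. f n * (t ^ n / (1 - t ^ n))"] by simp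
    then show "(\<lambda>n. f (Suc n) * (t ^ Suc n / (1 - t ^ Suc n))) sums S"
      by (rule has_sum_imp_sums)
    have "((\<lambda>(N, d). f d * t ^ N) has_sum S) (Sigma {0<..} (\<lambda>N. {d. d dvd N}))"
    proof (subst has_sum_reindex_bij_witness[where T = "{0<..} \<times> {0<..}" and h = g
          and j = "\<lambda>(N, d). (d, N div d)" and i = "\<lambda>(n, m). (n * m, n)"])
    qed (use S in \<open>auto simp: g_def dvd_div_eq_0_iff intro: Nat.gr0I\<close>)
    then have D: "((\<lambda>N. (\<Sum>d | d dvd N. f d) * t ^ N) has_sum S) {0<..}"
    proof (rule has_sum_SigmaD)
      fix N :: nat assume "N \<in> {0<..}"
      then have "((\<lambda>d. f d * t ^ N) has_sum (\<Sum>d | d dvd N. f d * t ^ N)) {d. d dvd N}"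
        by (intro has_sum_finite) auto
      then show "((\<lambda>d. case (N, d) of (N, d) \<Rightarrow> f d * t ^ N) has_sum (\<Sum>d | d dvd N. f d) * t ^ N) {d. d dvd N}"
        by (simp add: sum_distrib_right)
    qed
    fix K :: nat
    have "inj_on (\<lambda>k::nat. k\<^sup>2) {1..K}" by (auto simp: inj_on_def)
    then have "(\<Sum>N\<in>(\<lambda>k. k\<^sup>2) ` {1..K}. t ^ N) = (\<Sum>k=1..K. t ^ k\<^sup>2)"
      by (simp add: sum.reindex)
    moreover have "((\<lambda>N. t ^ N) has_sum (\<Sum>N\<in>(\<lambda>k. k\<^sup>2) ` {1..K}. t ^ N)) ((\<lambda>k. k\<^sup>2) ` {1..K})"
      by (rule has_sum_finite) auto
    ultimately have "((\<lambda>N. t ^ N) has_sum (\<Sum>k=1..K. t ^ k\<^sup>2)) ((\<lambda>k. k\<^sup>2) ` {1..K})"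
      by simp
    then show "(\<Sum>k=1..K. t ^ k\<^sup>2) \<le> S"
    proof (rule has_sum_mono_neutral[OF _ D])
      fix N assume "N \<in> (\<lambda>k. k\<^sup>2) ` {1..K} \<inter> {0<..}"
      then obtain k where "N = k\<^sup>2" "k > 0" by auto
      then have "(\<Sum>d | d dvd N. f d) \<ge> 1" using sum_divisors_nonneg[OF mult f1 vals] by blast
      then show "t ^ N \<le> (\<Sum>d | d dvd N. f d) * t ^ N" using t by simp
    next
      fix N :: nat assume "N \<in> {0<..} - (\<lambda>k. k\<^sup>2) ` {1..K}"
      then have "(\<Sum>d | d dvd N. f d) \<ge> 0" using sum_divisors_nonneg[OF mult f1 vals] by simp
      then show "0 \<le> (\<Sum>d | d dvd N. f d) * t ^ N" using t by simp
    qed auto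
  qed
qed

text \<open>The terms with indices i and n-1-i pair up by the inequality of arithmetic and geometric
  means. Writing the ratio as a square avoids the half-integral exponent (n-1)/2.\<close>

lemma geometric_sum_ge:
  fixes u :: real
  assumes "u \<ge> 0"
  shows "real n * u ^ (n - 1) \<le> (\<Sum>i<n. (u\<^sup>2) ^ i)"
proof -
  have "2 * u ^ (n - 1) \<le> (u\<^sup>2) ^ i + (u\<^sup>2) ^ (n - Suc i)" if "i < n" for i
  proof -
    have "u ^ (n - 1) = u ^ i * u ^ (n - Suc i)" using that by (simp add: power_add[symmetric])
    moreover have "0 \<le> (u ^ i - u ^ (n - Suc i))\<^sup>2" by simp
    moreover have "(u\<^sup>2) ^ j = (u ^ j)\<^sup>2" for j
      by (simp add: power_mult[symmetric] mult.commute)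
    ultimately show ?thesis by (simp add: power2_diff)
  qed
  then have "(\<Sum>i<n. 2 * u ^ (n - 1)) \<le> (\<Sum>i<n. (u\<^sup>2) ^ i + (u\<^sup>2) ^ (n - Suc i))"
    by (intro sum_mono) auto
  also have "\<dots> = 2 * (\<Sum>i<n. (u\<^sup>2) ^ i)"
    using sum.nat_diff_reindex[of "\<lambda>i. (u\<^sup>2) ^ i" n] by (simp add: sum.distrib)
  finally show ?thesis by simp
qed

text \<open>Monsky's proof of \<open>L(1, \<chi>) \<noteq> 0\<close>: if \<open>\<Sum> f(n)/n\<close> vanished, the Lambert series
  \<open>\<Sum> f(n) t\<^sup>n / (1 - t\<^sup>n)\<close> would equal \<open>- \<Sum> f(n) \<beta>(n)\<close> with the weights below and stay bounded as
  \<open>t \<rightarrow> 1\<close>, while its power series dominates \<open>\<Sum> t^(k\<^sup>2)\<close>.\<close>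
lemma monsky_weights:
  fixes t :: real
  assumes t: "0 < t" "t < 1"
  defines "\<beta> \<equiv> \<lambda>n. 1 / (real (Suc n) * (1 - t)) - t ^ Suc n / (1 - t ^ Suc n)"
  shows "\<beta> 0 = 1" and "\<beta> (Suc n) \<le> \<beta> n" and "\<beta> n \<ge> 0"
proof -
  define s where "s n = (\<Sum>i<n. t ^ i)" for n
  define u where "u = sqrt t"
  have u: "t = u\<^sup>2" "0 \<le> u" "u \<le> 1" using t by (auto simp: u_def)
  have st: "1 - t ^ n = (1 - t) * s n" for n
    using t by (simp add: s_def sum_gp_strict)
  have s_pos: "s (Suc n) > 0" for n
    unfolding s_def using t by (intro sum_pos) auto
  have \<beta>: "\<beta> n = (1 / real (Suc n) - t ^ Suc n / s (Suc n)) / (1 - t)" for n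
    unfolding \<beta>_def st by (simp add: diff_divide_distrib mult.commute)
  show "\<beta> 0 = 1" using t by (simp add: \<beta>_def field_simps)
  have s_Suc: "s (Suc n) = 1 + t * s n" for n
    by (simp add: s_def sum.lessThan_Suc_shift sum_distrib_left del: sum.lessThan_Suc)
  have s_ge: "s n \<ge> real n * u ^ (n - 1)" for n
    unfolding s_def u(1) by (rule geometric_sum_ge[OF u(2)])
  define a where "a = s (Suc n)"
  define b where "b = s (Suc (Suc n))"
  have ab: "a > 0" "b > 0" "b = 1 + t * a" unfolding a_def b_def by (rule s_pos s_Suc)+
  \<comment> \<open>Monotonicity reduces to such a bound: since b - t a = 1, the fractions t^(n+1)/a
    and t^(n+2)/b differ by t^(n+1)/(a b), to be compared with 1/((n+1)(n+2)).\<close>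
  have "(real (Suc n) * u ^ n) * (real (Suc (Suc n)) * u ^ Suc n) \<le> a * b"
    unfolding a_def b_def using s_ge[of "Suc n"] s_ge[of "Suc (Suc n)"] u s_pos[of n]
    by (intro mult_mono) auto
  moreover have "t ^ Suc n \<le> u ^ n * u ^ Suc n"
  proof -
    have "t ^ Suc n = u ^ (2 * Suc n)" unfolding u(1) by (rule power_mult[symmetric])
    also have "\<dots> \<le> u ^ (n + Suc n)" using u by (intro power_decreasing) auto
    finally show ?thesis by (simp only: power_add)
  qed
  then have "real (Suc n) * real (Suc (Suc n)) * t ^ Suc n \<le> real (Suc n) * real (Suc (Suc n)) * (u ^ n * u ^ Suc n)"
    by (intro mult_left_mono) auto
  ultimately have key: "real (Suc n) * real (Suc (Suc n)) * t ^ Suc n \<le> a * b"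
    by (simp only: mult.assoc mult.left_commute mult.commute)
  have "t ^ Suc n / a - t ^ Suc (Suc n) / b = t ^ Suc n * (b - t * a) / (a * b)"
    using ab(1,2) by (simp add: field_simps)
  also have "\<dots> = t ^ Suc n / (a * b)" using ab(3) by simp
  also have "\<dots> \<le> 1 / (real (Suc n) * real (Suc (Suc n)))"
    using key ab(1,2) by (simp add: divide_simps mult.commute del: of_nat_Suc)
  also have "\<dots> = 1 / real (Suc n) - 1 / real (Suc (Suc n))"
    by (simp add: field_simps)
  finally show "\<beta> (Suc n) \<le> \<beta> n"
    unfolding \<beta> using t by (intro divide_right_mono) (auto simp: a_def b_def)
  have "real (Suc n) * t ^ Suc n = (\<Sum>i<Suc n. t ^ Suc n)" by simp
  also have "\<dots> \<le> s (Suc n)"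
    unfolding s_def using t by (intro sum_mono power_decreasing) auto
  finally have "t ^ Suc n / s (Suc n) \<le> 1 / real (Suc n)"
    using s_pos[of n] by (simp add: divide_simps mult.commute del: of_nat_Suc)
  then show "\<beta> n \<ge> 0" unfolding \<beta> using t by (intro divide_nonneg_pos) auto
qed

text \<open>Summation by parts: for decreasing weights the differences are non-negative, so the
  bounds telescope to the first weight.\<close>

lemma abel_bound_antimono:
  fixes c \<beta> :: "nat \<Rightarrow> real"
  assumes S: "\<And>n. \<bar>\<Sum>k<n. c k\<bar> \<le> B" and \<beta>: "\<And>n. \<beta> (Suc n) \<le> \<beta> n" "\<And>n. \<beta> n \<ge> 0"
  shows "\<bar>\<Sum>k<N. c k * \<beta> k\<bar> \<le> B * \<beta> 0"
proof -
  have B: "B \<ge> 0" using S[of 0] by simp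
  have "(\<Sum>k<N. c k * \<beta> k) = (\<Sum>k<N. c k) * \<beta> N + (\<Sum>k<N. (\<Sum>i<Suc k. c i) * (\<beta> k - \<beta> (Suc k)))"
    by (induction N) (simp_all add: algebra_simps)
  also have "\<bar>\<dots>\<bar> \<le> \<bar>(\<Sum>k<N. c k) * \<beta> N\<bar> + (\<Sum>k<N. \<bar>(\<Sum>i<Suc k. c i) * (\<beta> k - \<beta> (Suc k))\<bar>)"
    by (intro order_trans[OF abs_triangle_ineq] add_mono sum_abs order_refl)
  also have "\<dots> \<le> B * \<beta> N + (\<Sum>k<N. B * (\<beta> k - \<beta> (Suc k)))"
  proof (intro add_mono sum_mono)
    show "\<bar>(\<Sum>k<N. c k) * \<beta> N\<bar> \<le> B * \<beta> N"
      using S[of N] \<beta>(2)[of N] by (simp add: abs_mult mult_right_mono)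
    show "\<bar>(\<Sum>i<Suc k. c i) * (\<beta> k - \<beta> (Suc k))\<bar> \<le> B * (\<beta> k - \<beta> (Suc k))" for k
      using S[of "Suc k"] \<beta>(1)[of k] by (simp add: abs_mult mult_right_mono del: sum.lessThan_Suc)
  qed
  also have "\<dots> = B * \<beta> 0"
    unfolding sum_distrib_left[symmetric] sum_lessThan_telescope' by (simp add: algebra_simps)
  finally show ?thesis .
qed

lemma sum_character_over_n_nonzero:
  fixes f :: "nat \<Rightarrow> real"
  assumes mult: "\<And>m n. f (m * n) = f m * f n" and f1: "f 1 = 1"
    and vals: "\<And>n. f n \<in> {- 1, 0, 1}" and B: "\<And>n. \<bar>\<Sum>k<n. f (Suc k)\<bar> \<le> B"
  shows "\<not> (\<lambda>n. f (Suc n) / real (Suc n)) sums 0"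
proof
  assume L: "(\<lambda>n. f (Suc n) / real (Suc n)) sums 0"
  have bound: "(\<Sum>k=1..K. t ^ (k\<^sup>2)) \<le> B" if t: "0 < t" "t < 1" for t K
  proof -
    define \<beta> where "\<beta> = (\<lambda>n. 1 / (real (Suc n) * (1 - t)) - t ^ Suc n / (1 - t ^ Suc n))"
    obtain S where S: "(\<lambda>n. f (Suc n) * (t ^ Suc n / (1 - t ^ Suc n))) sums S"
      "S \<ge> (\<Sum>k=1..K. t ^ (k\<^sup>2))"
      using lambert_series_ge[OF mult f1 vals t] by metis
    \<comment> \<open>The assumed zero sum enters scaled by 1/(1-t), because 1/(n(1-t)) cancels the
      pole of t^n/(1-t^n) at t = 1.\<close>
    have "(\<lambda>n. f (Suc n) / real (Suc n) * (1 / (1 - t)) - f (Suc n) * (t ^ Suc n / (1 - t ^ Suc n))) sums (0 * (1 / (1 - t)) - S)"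
      by (intro sums_diff sums_mult2 L S(1))
    also have "(\<lambda>n. f (Suc n) / real (Suc n) * (1 / (1 - t)) - f (Suc n) * (t ^ Suc n / (1 - t ^ Suc n))) = (\<lambda>n. f (Suc n) * \<beta> n)"
      by (simp add: \<beta>_def right_diff_distrib)
    finally have "(\<lambda>N. \<bar>\<Sum>n<N. f (Suc n) * \<beta> n\<bar>) \<longlonglongrightarrow> \<bar>0 * (1 / (1 - t)) - S\<bar>"
      unfolding sums_def by (rule tendsto_rabs)
    then have "\<bar>0 * (1 / (1 - t)) - S\<bar> \<le> B * \<beta> 0"
      by (rule LIMSEQ_le_const2)
        (use abel_bound_antimono[of "\<lambda>k. f (Suc k)" B \<beta>] B monsky_weights[OF t] in \<open>auto simp: \<beta>_def\<close>)
    also have "\<beta> 0 = 1" unfolding \<beta>_def by (rule monsky_weights[OF t])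
    finally show ?thesis using S(2) by simp
  qed
  \<comment> \<open>At t = 1 the sum of \<open>K\<close> powers is \<open>K\<close>, so letting
    \<open>t\<close> tend to 1 contradicts a bound that is uniform in \<open>t\<close>.\<close>
  obtain K :: nat where K: "real K > B" using reals_Archimedean2 by blast
  have "((\<lambda>t::real. \<Sum>k=1..K. t ^ (k\<^sup>2)) \<longlongrightarrow> (\<Sum>k=1..K. 1 ^ (k\<^sup>2))) (at_left 1)"
    by (intro tendsto_intros)
  moreover have "eventually (\<lambda>t::real. (\<Sum>k=1..K. t ^ (k\<^sup>2)) \<le> B) (at_left 1)"
    using eventually_at_left_real[of 0 1] by (rule eventually_mono) (use bound in auto)
  ultimately have "(\<Sum>k=1..K. 1 ^ (k\<^sup>2)) \<le> B"
    by (rule tendsto_upperbound) simp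
  then show False using K by simp
qed

section \<open>The half plane without zeros\<close>

lemma L_series_holomorphic:
  assumes "dirichlet_character q chi" "chi \<noteq> principal_character q"
  shows "Re s > 0 \<Longrightarrow> summable (L_term chi s)"
    and "(\<lambda>s. \<Sum>k. L_term chi s k) holomorphic_on {s. 0 < Re s}"
proof -
  note S = bounded_partial_sums_dirichlet_series[of "\<lambda>k. chi (Suc k)",
      OF dirichlet_character_partial_sum_Suc_bound[OF assms]]
  show "summable (L_term chi s)" if "Re s > 0"
    unfolding L_term_def[abs_def] using that by (rule S(1))
  have "(\<lambda>s. s * (\<Sum>k. (\<Sum>i\<le>k. chi (Suc i)) * power_gap k s)) holomorphic_on {s. 0 < Re s}"
    by (intro holomorphic_intros power_gap_series_holomorphic S(3)) auto
  then show "(\<lambda>s. \<Sum>k. L_term chi s k) holomorphic_on {s. 0 < Re s}"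
    by (rule holomorphic_transform) (simp add: L_term_def S(2)[symmetric])
qed

lemma L_one_nonzero:
  assumes chi: "dirichlet_character q chi" "chi \<noteq> principal_character q" and real: "real_character chi"
  shows "(\<Sum>k. L_term chi 1 k) \<noteq> 0"
proof
  assume 0: "(\<Sum>k. L_term chi 1 k) = 0"
  have chi_Re: "chi n = of_real (Re (chi n))" for n
    using real by (simp add: real_character_def complex_is_Real_iff complex_eq_iff)
  have "L_term chi 1 sums 0"
    using summable_sums[OF L_series_holomorphic(1)[OF chi, of 1]] 0 by simp
  moreover have "L_term chi 1 = (\<lambda>k. of_real (Re (chi (Suc k)) / real (Suc k)))"
  proof
    fix k
    have "(of_nat (Suc k) :: complex) powr (- 1) = inverse (of_nat (Suc k))"
      by (simp add: powr_def exp_minus del: of_nat_Suc Ln_of_nat)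
    then show "L_term chi 1 k = of_real (Re (chi (Suc k)) / real (Suc k))"
      unfolding L_term_def by (subst chi_Re) (simp add: divide_inverse del: of_nat_Suc)
  qed
  ultimately have "(\<lambda>k. of_real (Re (chi (Suc k)) / real (Suc k)) :: complex) sums of_real 0"
    by simp
  then have "(\<lambda>k. Re (chi (Suc k)) / real (Suc k)) sums 0"
    by (simp only: sums_of_real_iff)
  moreover have "\<not> (\<lambda>k. Re (chi (Suc k)) / real (Suc k)) sums 0"
  proof (rule sum_character_over_n_nonzero[where f = "\<lambda>n. Re (chi n)"])
    show "Re (chi (m * n)) = Re (chi m) * Re (chi n)" for m n
    proof -
      have "chi (m * n) = chi m * chi n" using chi by (simp add: dirichlet_character_def)
      also have "\<dots> = of_real (Re (chi m) * Re (chi n))"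
        using chi_Re[of m] chi_Re[of n] by (simp only: of_real_mult)
      finally show ?thesis by simp
    qed
    show "Re (chi 1) = 1" using dirichlet_character_1[OF chi(1)] by simp
    show "Re (chi n) \<in> {- 1, 0, 1}" for n by (rule real_dirichlet_character_values[OF chi(1) real])
    show "\<bar>\<Sum>k<n. Re (chi (Suc k))\<bar> \<le> real q + 1" for n
      using abs_Re_le_cmod[of "\<Sum>k<n. chi (Suc k)"]
        dirichlet_character_partial_sum_Suc_bound[OF chi, of n] by simp
  qed
  ultimately show False by blast
qed

text \<open>The trivial bound |A(N)| \<le> N, which uses \<sigma> \<ge> 0, makes the boundary term
  vanish once Re w > 1. This half plane is the starting region for the continuation.\<close>

lemma prime_partial_sum_power_gap_sums:
  assumes chi: "dirichlet_character q chi" and real: "real_character chi"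
    and \<sigma>: "0 \<le> \<sigma>" and w: "Re w > 1"
  shows "(\<lambda>k. of_real (prime_partial_sum chi \<sigma> (real (Suc k))) * power_gap k w) sums
    ((\<Sum>n. if prime n then chi n * of_nat n powr (- (w + of_real \<sigma>)) else 0) / w)"
proof -
  define c where "c k = (if prime (Suc k) then chi (Suc k) * of_real (real (Suc k) powr (- \<sigma>)) else 0)" for k
  define f where "f n = (if prime n then chi n * of_nat n powr (- (w + of_real \<sigma>)) else 0)" for n
  have w0: "w \<noteq> 0" using w by auto
  have chi_Re: "chi n = of_real (Re (chi n))" for n
    using real by (simp add: real_character_def complex_is_Real_iff complex_eq_iff)
  have cS: "(\<Sum>i\<le>k. c i) = of_real (prime_partial_sum chi \<sigma> (real (Suc k)))" for k
  proof -
    have "prime_partial_sum chi \<sigma> (real (Suc k)) = (\<Sum>p | prime p \<and> p \<le> Suc k. Re (chi p) * real p powr (- \<sigma>))"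
      by (simp add: prime_partial_sum_def del: of_nat_Suc)
    also have "\<dots> = (\<Sum>i | i \<le> k \<and> prime (Suc i). Re (chi (Suc i)) * real (Suc i) powr (- \<sigma>))"
      by (rule sum.reindex_bij_witness[of _ Suc "\<lambda>p. p - 1"]) (auto simp: prime_gt_0_nat)
    also have "\<dots> = (\<Sum>i\<le>k. if prime (Suc i) then Re (chi (Suc i)) * real (Suc i) powr (- \<sigma>) else 0)"
      by (rule sum.mono_neutral_cong_left) auto
    also have "of_real \<dots> = (\<Sum>i\<le>k. c i)"
      unfolding of_real_sum
    proof (rule sum.cong)
      fix i
      show "of_real (if prime (Suc i) then Re (chi (Suc i)) * real (Suc i) powr (- \<sigma>) else 0) = c i"
        unfolding c_def using chi_Re[of "Suc i"] by (simp del: of_nat_Suc)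
    qed simp
    finally show ?thesis by simp
  qed
  have c1: "norm (c k) \<le> 1" for k
  proof -
    have "real (Suc k) powr (- \<sigma>) \<le> 1" using \<sigma> powr_mono2'[of "- \<sigma>" 1 "real (Suc k)"] by simp
    then have "norm (chi (Suc k)) * real (Suc k) powr (- \<sigma>) \<le> 1 * 1"
      using dirichlet_character_norm_le[OF chi] by (intro mult_mono) auto
    then show ?thesis by (simp add: c_def norm_mult del: of_nat_Suc)
  qed
  have lim: "(\<lambda>N. (\<Sum>k<N. c k) * of_nat (Suc N) powr (- w)) \<longlonglongrightarrow> 0"
  proof (rule Lim_null_comparison)
    have "norm ((\<Sum>k<N. c k) * of_nat (Suc N) powr (- w)) \<le> real (Suc N) powr (- (Re w - 1))" for N
    proof -
      have "norm (\<Sum>k<N. c k) \<le> (\<Sum>k<N. 1)" by (rule sum_norm_le) (rule c1)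
      also have "\<dots> \<le> real (Suc N)" by simp
      finally have "norm ((\<Sum>k<N. c k) * of_nat (Suc N) powr (- w)) \<le> real (Suc N) * real (Suc N) powr (- Re w)"
        by (simp add: norm_mult norm_powr_of_nat mult_right_mono del: of_nat_Suc)
      also have "\<dots> = real (Suc N) powr (1 + - Re w)"
        unfolding powr_add by simp
      finally show ?thesis by simp
    qed
    then show "eventually (\<lambda>N. norm ((\<Sum>k<N. c k) * of_nat (Suc N) powr (- w)) \<le> real (Suc N) powr (- (Re w - 1))) sequentially"
      by simp
    show "(\<lambda>N. real (Suc N) powr (- (Re w - 1))) \<longlonglongrightarrow> 0"
      by (rule powr_neg_LIMSEQ_0) (use w in simp)
  qed
  have "summable f"
    unfolding f_def
    by (rule L_times_euler_correction(1)[where chi = chi, OF _ dirichlet_character_1[OF chi] dirichlet_character_norm_le[OF chi]])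
       (use chi w \<sigma> in \<open>auto simp: dirichlet_character_def\<close>)
  then have "f sums (\<Sum>n. f n)" by (rule summable_sums)
  moreover have "f 0 = 0" by (simp add: f_def)
  ultimately have "(\<lambda>k. f (Suc k)) sums (\<Sum>n. f n)"
    by (subst sums_Suc_iff) simp
  moreover have "f (Suc k) = c k * of_nat (Suc k) powr (- w)" for k
  proof -
    have "(of_nat (Suc k) :: complex) powr (- (w + of_real \<sigma>)) = of_nat (Suc k) powr (- w) * of_nat (Suc k) powr (- of_real \<sigma>)"
      by (simp add: powr_add[symmetric] del: of_nat_Suc)
    also have "(of_nat (Suc k) :: complex) powr (- of_real \<sigma>) = of_real (real (Suc k) powr (- \<sigma>))"
      using powr_of_real[of "real (Suc k)" "- \<sigma>"] by simp
    finally show ?thesis by (simp add: f_def c_def)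
  qed
  ultimately have "(\<lambda>k. c k * of_nat (Suc k) powr (- w)) sums (w * ((\<Sum>n. f n) / w))"
    using w0 by simp
  then have "(\<lambda>k. (\<Sum>i\<le>k. c i) * power_gap k w) sums ((\<Sum>n. f n) / w)"
    using abel_sums_power_gap_iff[OF w0 lim] by blast
  then show ?thesis unfolding cS f_def .
qed

theorem theorem1p1:
  fixes q :: nat and chi :: "nat \<Rightarrow> complex"
  assumes "dirichlet_character q chi"
    and "real_character chi"
    and "chi \<noteq> principal_character q"
    and "\<exists>\<sigma>::real. 0 \<le> \<sigma> \<and> \<sigma> < 1 \<and> finitely_many_sign_changes (prime_partial_sum chi \<sigma>)"
  shows "\<exists>\<epsilon>::real. \<epsilon> > 0 \<and> (\<forall>s::complex. Re s > 1 - \<epsilon> \<longrightarrow> dirichlet_L chi s \<noteq> 0)"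
proof -
  note chi = assms(1,3)
  obtain \<sigma> x0 where \<sigma>: "0 \<le> \<sigma>" "\<sigma> < 1"
    and sign: "(\<forall>x\<ge>x0. prime_partial_sum chi \<sigma> x \<ge> 0) \<or> (\<forall>x\<ge>x0. prime_partial_sum chi \<sigma> x \<le> 0)"
    using assms(4) unfolding finitely_many_sign_changes_def by blast
  \<comment> \<open>The eventual sign of the partial sums. It enters twice, in the coefficients
    \<open>a\<close> and as \<open>\<eta>\<close>, so its square 1 restores the prime sum.\<close>
  obtain \<kappa> :: real where \<kappa>: "\<kappa> * \<kappa> = 1" "\<forall>x\<ge>x0. \<kappa> * prime_partial_sum chi \<sigma> x \<ge> 0"
  proof (cases "\<forall>x\<ge>x0. prime_partial_sum chi \<sigma> x \<ge> 0")
    case True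
    then show ?thesis by (intro that[of 1]) auto
  next
    case False
    then show ?thesis using sign by (intro that[of "- 1"]) auto
  qed
  define L where "L = (\<lambda>s. \<Sum>k. L_term chi s k)"
  define E where "E = euler_correction chi"
  have L_hol: "L holomorphic_on {s. 0 < Re s}"
    unfolding L_def by (rule L_series_holomorphic(2)[OF chi])
  have E_hol: "E holomorphic_on {s. 1/2 < Re s}"
    unfolding E_def by (rule euler_correction_holomorphic[OF dirichlet_character_norm_le[OF chi(1)]])
  have E_nz: "E s \<noteq> 0" if "Re s > 1/2" for s
    unfolding E_def using that by (rule euler_correction_nonzero[OF dirichlet_character_norm_le[OF chi(1)]])
  have LE: "L s * E s = exp (\<Sum>n. if prime n then chi n * of_nat n powr (- s) else 0)" if "Re s > 1" for s
    unfolding L_def E_def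
    by (rule L_times_euler_correction(2)[where chi = chi, OF _ dirichlet_character_1[OF chi(1)] dirichlet_character_norm_le[OF chi(1)] that])
       (use chi in \<open>auto simp: dirichlet_character_def\<close>)
  have "continuous_on {s. 0 < Re s} L" using L_hol by (rule holomorphic_on_imp_continuous_on)
  then have "isCont L 1"
    by (subst (asm) continuous_on_eq_continuous_at[OF open_halfspace_Re_gt]) auto
  moreover have "L 1 \<noteq> 0" unfolding L_def by (rule L_one_nonzero[OF chi assms(2)])
  ultimately obtain \<delta> where \<delta>: "\<delta> > 0" "\<And>s. dist 1 s < \<delta> \<Longrightarrow> L s \<noteq> 0"
    using continuous_at_avoid[of 1 L 0] by auto
  \<comment> \<open>Three barriers: Re w = Re s - \<sigma> must stay positive, the product
    \<open>E\<close> needs Re s > 1/2, and real points down to 1 - \<delta> are known not to be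
    zeros of \<open>L\<close>.\<close>
  define y where "y = max (max \<sigma> (1/2)) (1 - \<delta>)"
  have y: "y < 1" "\<sigma> \<le> y" "1/2 \<le> y" "1 - \<delta> \<le> y" using \<sigma> \<delta>(1) by (simp_all add: y_def le_max_iff_disj)
  define M where "M w = L (w + of_real \<sigma>) * E (w + of_real \<sigma>)" for w
  define a where "a k = \<kappa> * prime_partial_sum chi \<sigma> (real (Suc k))" for k
  have M_nz: "M w \<noteq> 0" if w: "Re w > y - \<sigma>" for w
  proof (rule landau_power_gap_series[where a = a and \<eta> = "of_real \<kappa>" and X = 1
        and N = "nat \<lceil>x0\<rceil>" and \<alpha> = "y - \<sigma>" and M = M])
    show "a n \<ge> 0" if "n \<ge> nat \<lceil>x0\<rceil>" for n
    proof -
      have "x0 \<le> real (Suc n)" using that by linarith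
      then show ?thesis using \<kappa>(2) by (simp add: a_def)
    qed
    have img: "(\<lambda>w. w + complex_of_real \<sigma>) ` {w. y - \<sigma> < Re w} \<subseteq> {s. 1/2 < Re s}"
      "(\<lambda>w. w + complex_of_real \<sigma>) ` {w. y - \<sigma> < Re w} \<subseteq> {s. 0 < Re s}"
      using y by auto
    have h: "(\<lambda>w. w + complex_of_real \<sigma>) holomorphic_on {w. y - \<sigma> < Re w}"
      by (intro holomorphic_intros)
    show "M holomorphic_on {w. y - \<sigma> < Re w}"
      unfolding M_def
      using holomorphic_on_mult[OF holomorphic_on_compose_gen[OF h L_hol img(2)]
          holomorphic_on_compose_gen[OF h E_hol img(1)]] by (simp add: o_def)
    show "M (of_real x) \<noteq> 0" if x: "x > y - \<sigma>" for x
    \<comment> \<open>To the right of 1 the value is an exponential; between \<open>y\<close> and 1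
      the point x + \<sigma> lies within \<delta> of 1.\<close>
    proof (cases "x + \<sigma> > 1")
      case True
      then show ?thesis using LE[of "of_real x + of_real \<sigma>"] by (simp add: M_def)
    next
      case False
      have "dist 1 (complex_of_real (x + \<sigma>)) = \<bar>1 - (x + \<sigma>)\<bar>"
        by (metis dist_norm norm_of_real of_real_1 of_real_diff)
      then have "L (of_real (x + \<sigma>)) \<noteq> 0" using False x y by (intro \<delta>) auto
      moreover have "E (of_real (x + \<sigma>)) \<noteq> 0" using x y by (intro E_nz) auto
      ultimately show ?thesis by (simp add: M_def)
    qed
    fix w :: complex assume w: "Re w > 1"
    define P where "P = (\<Sum>n. if prime n then chi n * of_nat n powr (- (w + of_real \<sigma>)) else 0)"
    have s: "(\<lambda>k. of_real (a k) * power_gap k w) sums (of_real \<kappa> * (P / w))"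
      using sums_mult[OF prime_partial_sum_power_gap_sums[OF chi(1) assms(2) \<sigma>(1) w], of "of_real \<kappa>"]
      by (simp add: a_def P_def mult.assoc)
    then show "summable (\<lambda>k. of_real (a k) * power_gap k w)" by (rule sums_summable)
    have "of_real \<kappa> * of_real \<kappa> = (1 :: complex)" using \<kappa>(1) by (metis of_real_1 of_real_mult)
    then have "of_real \<kappa> * w * (of_real \<kappa> * (P / w)) = P"
      using w by (auto simp: field_simps)
    then show "M w = exp (of_real \<kappa> * w * (\<Sum>k. of_real (a k) * power_gap k w))"
      unfolding sums_unique[OF s, symmetric] M_def using LE[of "w + of_real \<sigma>"] w \<sigma>
      by (simp add: P_def)
  qed (use y \<kappa> w in auto)
  show ?thesis
  proof (intro exI[of _ "1 - y"] conjI allI impI)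
    show "1 - y > 0" using y by simp
    fix s :: complex assume "Re s > 1 - (1 - y)"
    then have "L s \<noteq> 0" using M_nz[of "s - of_real \<sigma>"] by (simp add: M_def)
    \<comment> \<open>As Re s > y \<ge> 1/2, \<open>dirichlet_L\<close> takes its series
      branch.\<close>
    moreover have "summable (L_term chi s)"
      by (rule L_series_holomorphic(1)[OF chi]) (use y \<open>Re s > 1 - (1 - y)\<close> in simp)
    ultimately show "dirichlet_L chi s \<noteq> 0" by (simp add: dirichlet_L_def L_def)
  qed
qed

end
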